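(* (a) Let $n\in\mathbb{N}$. In the ring of formal power series in the variables $t_1,\ldots,t_n$ one has $$\log\mathfrak{F}(t_1,\ldots,t_n)=-\sum_{\ell=1}^{n-1}\,\sum_{m\in\mathbb{N}^{\ell}}\alpha(m)\sum_{k=1}^{n-\ell}\,\prod_{j=1}^{\ell}\left(t_{k+j-1}t_{k+j}\right)^{m_j}.$$ (b) For every complex sequence $x=\{x_k\}_{k=1}^{\infty}$ such that $\sum_{k=1}^{\infty}|x_kx_{k+1}|<\log 2$ one has $$\log\mathfrak{F}(x)=-\sum_{\ell=1}^{\infty}\,\sum_{m\in\mathbb{N}^{\ell}}\alpha(m)\sum_{k=1}^{\infty}\,\prod_{j=1}^{\ell}\left(x_{k+j-1}x_{k+j}\right)^{m_j}.$$
   Context: $\mathbb{N}=\{1,2,3,\ldots\}$. Let $D=\{\{x_k\}_{k=1}^\infty\subset\mathbb{C};\ \sum_{k=1}^\infty|x_kx_{k+1}|<\infty\}$ and define $\mathfrak{F}:D\to\mathbb{C}$ by $$\mathfrak{F}(x)=1+\sum_{m=1}^{\infty}(-1)^m\sum_{k_1=1}^{\infty}\,\sum_{k_2=k_1+2}^{\infty}\cdots\sum_{k_m=k_{m-1}+2}^{\infty}x_{k_1}x_{k_1+1}x_{k_2}x_{k_2+1}\cdots x_{k_m}x_{k_m+1}.$$ For finitely many variables, $\mathfrak{F}(x_1,\ldots,x_n)$ means $\mathfrak{F}(x_1,\ldots,x_n,0,0,0,\ldots)$; it is a polynomial in $x_1,\ldots,x_n$ with constant term $1$, so $\log\mathfrak{F}(t_1,\ldots,t_n)$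 makes sense as a formal power series. For $x\in D$ one has $|\mathfrak{F}(x)-1|\le\exp(\sum_k|x_kx_{k+1}|)-1$; hence under the hypothesis of (b), $|\mathfrak{F}(x)-1|<1$, and $\log$ in (b) is the principal branch. For a multiindex $m=(m_1,\ldots,m_\ell)\in\mathbb{N}^\ell$ put $$\beta(m)=\prod_{j=1}^{\ell-1}\binom{m_j+m_{j+1}-1}{m_{j+1}},\qquad \alpha(m)=\frac{\beta(m)}{m_1},$$ where an empty product equals $1$. *)

theory Defs
  imports "HOL-Analysis.Analysis" "HOL-Library.Poly_Mapping"
begin

section \<open>Multivariate formal power series\<close>

text \<open>
  Formal power series in the indeterminates \<open>t\<^sub>0, t\<^sub>1, t\<^sub>2, \<dots>\<close>: a monomial is its finitely supported
  exponent vector of type \<^typ>\<open>nat \<Rightarrow>\<^sub>0 nat\<close>, and a series is an arbitrary family of coefficients. For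
  every \<open>n\<close> the ring of power series in \<open>t\<^sub>1, \<dots>, t\<^sub>n\<close> is the subring of those series all of whose
  monomials are supported in \<open>{1..n}\<close>.
\<close>

typedef 'a mfps = "UNIV :: ((nat \<Rightarrow>\<^sub>0 nat) \<Rightarrow> 'a) set"
  morphisms mfps_coeff MFPS
  by simp

lemma mfps_coeff_MFPS [simp]: "mfps_coeff (MFPS f) = f"
  by (simp add: MFPS_inverse)

lemma mfps_eqI: "(\<And>u. mfps_coeff f u = mfps_coeff g u) \<Longrightarrow> f = g"
  by (metis ext mfps_coeff_inject)

definition monom_splits :: "(nat \<Rightarrow>\<^sub>0 nat) \<Rightarrow> ((nat \<Rightarrow>\<^sub>0 nat) \<times> (nat \<Rightarrow>\<^sub>0 nat)) set"
  where "monom_splits u = {(v, w). v + w = u}"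

lemma finite_monom_splits [simp]: "finite (monom_splits u)"
proof -
  let ?K = "Poly_Mapping.keys u"
  let ?B = "{v. \<exists>w. v + w = u}"
  have "inj_on (\<lambda>v. restrict (Poly_Mapping.lookup v) ?K) ?B"
  proof (rule inj_onI)
    fix v v'
    assume v: "v \<in> ?B" and v': "v' \<in> ?B"
      and eq: "restrict (Poly_Mapping.lookup v) ?K = restrict (Poly_Mapping.lookup v') ?K"
    show "v = v'"
    proof (rule poly_mapping_eqI)
      fix i
      show "Poly_Mapping.lookup v i = Poly_Mapping.lookup v' i"
      proof (cases "i \<in> ?K")
        case True
        then show ?thesis using fun_cong[OF eq, of i] by simp
      next
        case False
        then have "Poly_Mapping.lookup u i = 0" by (simp add: in_keys_iff)
        then have "Poly_Mapping.lookup z i = 0" if "z \<in> ?B" for z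
          using that by (auto simp: lookup_add)
        with v v' show ?thesis by simp
      qed
    qed
  qed
  moreover have "(\<lambda>v. restrict (Poly_Mapping.lookup v) ?K) ` ?B
      \<subseteq> (\<Pi>\<^sub>E i\<in>?K. {..Poly_Mapping.lookup u i})"
    by (auto simp: lookup_add)
  moreover have "finite (\<Pi>\<^sub>E i\<in>?K. {..Poly_Mapping.lookup u i})"
    by (intro finite_PiE) auto
  ultimately have "finite ?B"
    by (meson finite_imageD finite_subset)
  moreover have "monom_splits u \<subseteq> (\<lambda>v. (v, u - v)) ` ?B"
    by (auto simp: monom_splits_def image_iff)
  ultimately show ?thesis
    by (meson finite_imageI finite_subset)
qed

instantiation mfps :: (comm_ring_1) comm_ring_1
begin

definition "0 = MFPS (\<lambda>_. 0)"
definition "1 = MFPS (\<lambda>u. if u = 0 then 1 else 0)"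
definition "f + g = MFPS (\<lambda>u. mfps_coeff f u + mfps_coeff g u)"
definition "f - g = MFPS (\<lambda>u. mfps_coeff f u - mfps_coeff g u)"
definition "- f = MFPS (\<lambda>u. - mfps_coeff f u)"
definition "f * g = MFPS (\<lambda>u. \<Sum>(v, w)\<in>monom_splits u. mfps_coeff f v * mfps_coeff g w)"

instance
proof
  fix a b c :: "'a mfps"
  show "a + b + c = a + (b + c)" "a + b = b + a" "0 + a = a" "- a + a = 0" "a - b = a + - b"
    by (auto intro!: mfps_eqI
          simp: plus_mfps_def zero_mfps_def uminus_mfps_def minus_mfps_def add.assoc add.commute)
  show "(0::'a mfps) \<noteq> 1"
  proof
    assume "(0::'a mfps) = 1"
    then have "mfps_coeff (0::'a mfps) 0 = mfps_coeff 1 0" by simp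
    then show False by (simp add: zero_mfps_def one_mfps_def)
  qed
  show "a * b = b * a"
  proof (rule mfps_eqI)
    fix u
    show "mfps_coeff (a * b) u = mfps_coeff (b * a) u"
      unfolding times_mfps_def mfps_coeff_MFPS
      by (rule sum.reindex_bij_witness[of _ "\<lambda>(v, w). (w, v)" "\<lambda>(v, w). (w, v)"])
         (auto simp: monom_splits_def add.commute mult.commute)
  qed
  show "(a + b) * c = a * c + b * c"
    by (rule mfps_eqI)
       (simp add: plus_mfps_def times_mfps_def case_prod_beta algebra_simps sum.distrib)
  show "1 * a = a"
  proof (rule mfps_eqI)
    fix u
    have "mfps_coeff (1 * a) u
        = (\<Sum>p\<in>monom_splits u. if p = (0, u) then mfps_coeff a u else 0)"
      unfolding times_mfps_def one_mfps_def mfps_coeff_MFPS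
      by (rule sum.cong) (auto simp: monom_splits_def split: if_splits)
    also have "\<dots> = mfps_coeff a u"
      using finite_monom_splits[of u] by (simp add: sum.delta) (simp add: monom_splits_def)
    finally show "mfps_coeff (1 * a) u = mfps_coeff a u" .
  qed
  show "a * b * c = a * (b * c)"
  proof (rule mfps_eqI)
    fix u
    have "mfps_coeff (a * b * c) u
        = (\<Sum>(p, q)\<in>(SIGMA p:monom_splits u. monom_splits (fst p)).
            mfps_coeff a (fst q) * mfps_coeff b (snd q) * mfps_coeff c (snd p))"
      by (subst sum.Sigma[symmetric])
         (auto simp: times_mfps_def case_prod_beta sum_distrib_right)
    also have "\<dots> = (\<Sum>(p, q)\<in>(SIGMA p:monom_splits u. monom_splits (snd p)).
            mfps_coeff a (fst p) * (mfps_coeff b (fst q) * mfps_coeff c (snd q)))"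
      by (rule sum.reindex_bij_witness[of _
            "\<lambda>(p, q). ((fst p + fst q, snd q), (fst p, fst q))"
            "\<lambda>(p, q). ((fst q, snd q + snd p), (snd q, snd p))"])
         (auto simp: monom_splits_def ac_simps)
    also have "\<dots> = mfps_coeff (a * (b * c)) u"
      by (subst sum.Sigma[symmetric])
         (auto simp: times_mfps_def case_prod_beta sum_distrib_left)
    finally show "mfps_coeff (a * b * c) u = mfps_coeff (a * (b * c)) u" .
  qed
qed

end

text \<open>
  The usual topology of a power series ring, the product topology over discrete coefficients. It is
  what gives a meaning to infinite sums of formal power series.
\<close>

instantiation mfps :: (type) t2_space
begin

definition "open (U :: 'a mfps set) \<longleftrightarrow>
  (\<forall>f\<in>U. \<exists>M. finite M \<and> (\<forall>g. (\<forall>u\<in>M. mfps_coeff g u = mfps_coeff f u) \<longrightarrow> g \<in> U))"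

instance
proof
  show "open (UNIV :: 'a mfps set)"
    by (auto simp: open_mfps_def)
next
  fix S T :: "'a mfps set"
  assume S: "open S" and T: "open T"
  show "open (S \<inter> T)"
    unfolding open_mfps_def
  proof
    fix f assume f: "f \<in> S \<inter> T"
    obtain M where M: "finite M" "\<And>g. (\<forall>u\<in>M. mfps_coeff g u = mfps_coeff f u) \<Longrightarrow> g \<in> S"
      using S f unfolding open_mfps_def by blast
    obtain N where N: "finite N" "\<And>g. (\<forall>u\<in>N. mfps_coeff g u = mfps_coeff f u) \<Longrightarrow> g \<in> T"
      using T f unfolding open_mfps_def by blast
    show "\<exists>M. finite M \<and> (\<forall>g. (\<forall>u\<in>M. mfps_coeff g u = mfps_coeff f u) \<longrightarrow> g \<in> S \<inter> T)"
    proof (intro exI[of _ "M \<union> N"] conjI allI impI)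
      show "finite (M \<union> N)" using M(1) N(1) by simp
    next
      fix g assume "\<forall>u\<in>M \<union> N. mfps_coeff g u = mfps_coeff f u"
      then have "\<forall>u\<in>M. mfps_coeff g u = mfps_coeff f u" "\<forall>u\<in>N. mfps_coeff g u = mfps_coeff f u"
        by blast+
      then show "g \<in> S \<inter> T" using M(2) N(2) by blast
    qed
  qed
next
  fix K :: "'a mfps set set"
  assume K: "\<forall>S\<in>K. open S"
  show "open (\<Union>K)"
    unfolding open_mfps_def
  proof
    fix f assume "f \<in> \<Union>K"
    then obtain S where S: "S \<in> K" "f \<in> S" by blast
    with K obtain M where "finite M" "\<forall>g. (\<forall>u\<in>M. mfps_coeff g u = mfps_coeff f u) \<longrightarrow> g \<in> S"
      unfolding open_mfps_def by blast
    with S show "\<exists>M. finite M \<and> (\<forall>g. (\<forall>u\<in>M. mfps_coeff g u = mfps_coeff f u) \<longrightarrow> g \<in> \<Union>K)"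
      by blast
  qed
next
  fix f g :: "'a mfps"
  assume "f \<noteq> g"
  then obtain u where u: "mfps_coeff f u \<noteq> mfps_coeff g u"
    using mfps_eqI by blast
  have op: "open {h. mfps_coeff h u = c}" for c :: 'a
    unfolding open_mfps_def by (auto intro!: exI[of _ "{u}"])
  show "\<exists>U V. open U \<and> open V \<and> f \<in> U \<and> g \<in> V \<and> U \<inter> V = {}"
    using u
    by (intro exI[of _ "{h. mfps_coeff h u = mfps_coeff f u}"]
              exI[of _ "{h. mfps_coeff h u = mfps_coeff g u}"]) (auto simp: op)
qed

end

lemma tendsto_mfps_iff:
  "(f \<longlongrightarrow> l) F \<longleftrightarrow> (\<forall>u. \<forall>\<^sub>F x in F. mfps_coeff (f x) u = mfps_coeff l u)"
proof (intro iffI allI)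
  fix u
  have "open {h. mfps_coeff h u = mfps_coeff l u}"
    unfolding open_mfps_def by (auto intro!: exI[of _ "{u}"])
  moreover assume "(f \<longlongrightarrow> l) F"
  ultimately show "\<forall>\<^sub>F x in F. mfps_coeff (f x) u = mfps_coeff l u"
    by (auto dest: topological_tendstoD)
next
  assume *: "\<forall>u. \<forall>\<^sub>F x in F. mfps_coeff (f x) u = mfps_coeff l u"
  show "(f \<longlongrightarrow> l) F"
  proof (rule topological_tendstoI)
    fix S assume "open S" "l \<in> S"
    then obtain M where M: "finite M" "\<And>g. (\<forall>u\<in>M. mfps_coeff g u = mfps_coeff l u) \<Longrightarrow> g \<in> S"
      unfolding open_mfps_def by blast
    from M(1) have "\<forall>\<^sub>F x in F. \<forall>u\<in>M. mfps_coeff (f x) u = mfps_coeff l u"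
      using * by (simp add: eventually_ball_finite)
    then show "\<forall>\<^sub>F x in F. f x \<in> S"
      by eventually_elim (rule M(2))
  qed
qed

lemma mfps_coeff_sum: "mfps_coeff (\<Sum>i\<in>A. f i) u = (\<Sum>i\<in>A. mfps_coeff (f i) u)"
  by (induction A rule: infinite_finite_induct) (simp_all add: zero_mfps_def plus_mfps_def)

text \<open>
  Convergent sums are exactly the classical summable families of formal power series: each monomial
  occurs in only finitely many of the summands.
\<close>

lemma has_sum_mfps_iff:
  fixes f :: "'b \<Rightarrow> 'a::comm_ring_1 mfps"
  shows "(f has_sum s) A \<longleftrightarrow>
    (\<forall>u. finite {i\<in>A. mfps_coeff (f i) u \<noteq> 0} \<and>
         mfps_coeff s u = (\<Sum>i | i \<in> A \<and> mfps_coeff (f i) u \<noteq> 0. mfps_coeff (f i) u))"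
proof -
  have "(\<forall>\<^sub>F X in finite_subsets_at_top A. mfps_coeff (sum f X) u = mfps_coeff s u) \<longleftrightarrow>
      finite {i\<in>A. mfps_coeff (f i) u \<noteq> 0} \<and>
      mfps_coeff s u = (\<Sum>i | i \<in> A \<and> mfps_coeff (f i) u \<noteq> 0. mfps_coeff (f i) u)"
    (is "?L \<longleftrightarrow> finite ?S \<and> _") for u
  proof
    assume ?L
    then have "\<exists>X. finite X \<and> X \<subseteq> A \<and>
        (\<forall>Y. finite Y \<and> X \<subseteq> Y \<and> Y \<subseteq> A \<longrightarrow> mfps_coeff (sum f Y) u = mfps_coeff s u)"
      unfolding eventually_finite_subsets_at_top .
    then obtain X where X: "finite X" "X \<subseteq> A"
      and Y: "\<forall>Y. finite Y \<and> X \<subseteq> Y \<and> Y \<subseteq> A \<longrightarrow> mfps_coeff (sum f Y) u = mfps_coeff s u"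
      by (elim exE conjE)
    have sX: "mfps_coeff (sum f X) u = mfps_coeff s u"
      using X Y by simp
    have sub: "?S \<subseteq> X"
    proof
      fix i assume i: "i \<in> ?S"
      show "i \<in> X"
      proof (rule ccontr)
        assume "i \<notin> X"
        moreover have "mfps_coeff (sum f (insert i X)) u = mfps_coeff s u"
          using X Y i by (simp add: subset_insertI)
        ultimately show False
          using X i sX by (simp add: mfps_coeff_sum plus_mfps_def)
      qed
    qed
    then have "(\<Sum>i\<in>?S. mfps_coeff (f i) u) = (\<Sum>i\<in>X. mfps_coeff (f i) u)"
      using X by (intro sum.mono_neutral_left) auto
    with sub X sX show "finite ?S \<and> mfps_coeff s u = (\<Sum>i\<in>?S. mfps_coeff (f i) u)"
      by (auto simp: mfps_coeff_sum intro: finite_subset)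
  next
    assume S: "finite ?S \<and> mfps_coeff s u = (\<Sum>i\<in>?S. mfps_coeff (f i) u)"
    show ?L
      unfolding eventually_finite_subsets_at_top
    proof (intro exI[of _ ?S] conjI allI impI)
      fix Y assume Y: "finite Y \<and> ?S \<subseteq> Y \<and> Y \<subseteq> A"
      then have "(\<Sum>i\<in>?S. mfps_coeff (f i) u) = (\<Sum>i\<in>Y. mfps_coeff (f i) u)"
        by (intro sum.mono_neutral_left) auto
      with S show "mfps_coeff (sum f Y) u = mfps_coeff s u"
        by (simp add: mfps_coeff_sum)
    qed (use S in auto)
  qed
  then show ?thesis
    unfolding has_sum_def tendsto_mfps_iff by blast
qed

definition mfps_const :: "'a::zero \<Rightarrow> 'a mfps"
  where "mfps_const c = MFPS (\<lambda>u. if u = 0 then c else 0)"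

definition mfps_var :: "nat \<Rightarrow> 'a::zero_neq_one mfps"
  where "mfps_var k = MFPS (\<lambda>u. if u = Poly_Mapping.single k 1 then 1 else 0)"

text \<open>The formal logarithm of a power series with constant term \<open>1\<close>.\<close>

definition mfps_log :: "'a::field_char_0 mfps \<Rightarrow> 'a mfps"
  where "mfps_log f = (\<Sum>\<^sub>\<infinity>r\<in>{1..}. mfps_const ((- 1) ^ (r + 1) / of_nat r) * (f - 1) ^ r)"

section \<open>The function \<open>\<FF>\<close>\<close>

text \<open>Sequences are indexed from \<open>1\<close>; the value at index \<open>0\<close> is irrelevant throughout.\<close>

definition D_space :: "(nat \<Rightarrow> complex) set"
  where "D_space = {x. (\<lambda>k. norm (x k * x (k + 1))) summable_on {1..}}"

text \<open>
  \<open>F_nested x m a p\<close> is the \<open>m\<close>-fold iterated sum over \<open>k\<^sub>1 \<ge> a\<close>, \<open>k\<^sub>2 \<ge> k\<^sub>1 + 2\<close>, \dots,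
  \<open>k\<^sub>m \<ge> k\<^sub>m\<^sub>-\<^sub>1 + 2\<close> of \<open>p \<cdot> x\<^bsub>k\<^sub>1\<^esub> x\<^bsub>k\<^sub>1+1\<^esub> \<cdots> x\<^bsub>k\<^sub>m\<^esub> x\<^bsub>k\<^sub>m+1\<^esub>\<close>. It is used both for complex sequences and
  for sequences of formal power series.
\<close>

fun F_nested :: "(nat \<Rightarrow> 'a::{comm_ring_1,t2_space}) \<Rightarrow> nat \<Rightarrow> nat \<Rightarrow> 'a \<Rightarrow> 'a" where
  "F_nested x 0 a p = p"
| "F_nested x (Suc m) a p = (\<Sum>\<^sub>\<infinity>k\<in>{a..}. F_nested x m (k + 2) (p * x k * x (k + 1)))"

definition F_fun :: "(nat \<Rightarrow> 'a::{comm_ring_1,t2_space}) \<Rightarrow> 'a"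
  where "F_fun x = 1 + (\<Sum>\<^sub>\<infinity>m\<in>{1..}. (- 1) ^ m * F_nested x m 1 1)"

definition truncate_seq :: "nat \<Rightarrow> (nat \<Rightarrow> 'a::zero) \<Rightarrow> nat \<Rightarrow> 'a"
  where "truncate_seq n x = (\<lambda>k. if k \<in> {1..n} then x k else 0)"

section \<open>Multiindices\<close>

definition multiindices :: "nat \<Rightarrow> (nat \<Rightarrow> nat) set"
  where "multiindices l = {1..l} \<rightarrow>\<^sub>E {1..}"

definition beta_coeff :: "nat \<Rightarrow> (nat \<Rightarrow> nat) \<Rightarrow> nat"
  where "beta_coeff l m = (\<Prod>j\<in>{1..<l}. (m j + m (j + 1) - 1) choose m (j + 1))"

definition alpha_coeff :: "nat \<Rightarrow> (nat \<Rightarrow> nat) \<Rightarrow> complex"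
  where "alpha_coeff l m = of_nat (beta_coeff l m) / of_nat (m 1)"

end

theory Submission
  imports Defs
begin

text \<open>
  Put \<open>w k = x k * x (k + 1)\<close>. Splitting the iterated sums according to whether the first index is \<open>a\<close>
  gives the recurrence \<open>F a = F (a + 1) - w a * F (a + 2)\<close> for the function \<open>\<FF>\<close> of the shifted sequences
  (\<open>F_tail_rec\<close>). If only \<open>x 1, \<dots>, x n\<close> are nonzero, the inverse ratios \<open>h k = F (k + 1) / F k\<close> therefore
  satisfy \<open>(1 - w k * h (k + 1)) * h k = 1\<close>, and \<open>\<FF>(x)\<close> is the product of the factors
  \<open>1 - w k * h (k + 1)\<close> for \<open>1 \<le> k < n\<close> (\<open>F_fun_finite_eq_prod\<close>).

  Iterating the negative binomial series of \<open>(1 - w k * h (k + 1))\<close> to the power \<open>- s\<close> expresses \<open>h k ^ s\<close> as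
  the sum, over all multiindices \<open>m\<close> including the empty one, of \<open>((s + m\<^sub>1 - 1) choose m\<^sub>1) * \<beta>(m)\<close>
  times the monomial in \<open>w k, w (k + 1), \<dots>\<close> with exponents \<open>m\<close> (\<open>cf_sum_step\<close>). Inserting this for \<open>h (k + 1) ^ p\<close> into the sum of
  \<open>(w k * h (k + 1)) ^ p / p\<close> over \<open>p \<ge> 1\<close> shows that \<open>- log (1 - w k * h (k + 1))\<close> is the sum of the
  monomials starting at \<open>w k\<close> with coefficients \<open>\<alpha>(m)\<close> (\<open>has_sum_ne_pos_lists\<close>). Summation over \<open>k\<close> gives
  both expansions. The algebra is the same for formal power series and for complex numbers and is carried
  out in a topological ring; only the summability of the families is proved separately.

  For formal power series summability follows from the orders of the monomials, and what remains is that the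
  formal logarithm turns products into sums. This is shown with the Euler operator, a derivation that is
  injective on series without constant term (\<open>mfps_log_mult\<close>).

  For complex sequences the families are first bounded in the case of nonnegative \<open>w\<close>, where
  \<open>h k \<le> (1 - \<sigma> (k + 1)) / (1 - \<sigma> k)\<close> with \<open>\<sigma> k\<close> the sum of the \<open>w i\<close> from \<open>k\<close> on. The logarithms of these
  bounds telescope, so the whole family of terms, indexed by \<open>k\<close> and \<open>m\<close>, is absolutely summable, and
  the sum of the absolute values is at most \<open>- ln (1 - \<sigma> 1)\<close>, which for \<open>\<sigma> 1 < ln 2\<close> is less
  than \<open>2\<close> (\<open>log_family_summable_real\<close>, \<open>ln2_bound\<close>). The identity between \<open>\<FF>\<close> and the exponential passes to the limit from finitely many variables, and since \<open>2 < pi\<close> the sum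
  is the principal value of the logarithm (\<open>Ln_F_fun\<close>).
\<close>

section \<open>The ring of formal power series as a topological ring\<close>

lemma mfps_coeff_0 [simp]: "mfps_coeff (0 :: 'a::comm_ring_1 mfps) u = 0"
  by (simp add: zero_mfps_def)

lemma mfps_coeff_1: "mfps_coeff (1 :: 'a::comm_ring_1 mfps) u = (if u = 0 then 1 else 0)"
  by (simp add: one_mfps_def)

lemma mfps_coeff_add [simp]:
  "mfps_coeff (f + g :: 'a::comm_ring_1 mfps) u = mfps_coeff f u + mfps_coeff g u"
  by (simp add: plus_mfps_def)

lemma mfps_coeff_uminus [simp]: "mfps_coeff (- f :: 'a::comm_ring_1 mfps) u = - mfps_coeff f u"
  by (simp add: uminus_mfps_def)

lemma mfps_coeff_diff [simp]:
  "mfps_coeff (f - g :: 'a::comm_ring_1 mfps) u = mfps_coeff f u - mfps_coeff g u"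
  by (simp add: minus_mfps_def)

lemma mfps_coeff_mult:
  "mfps_coeff (f * g :: 'a::comm_ring_1 mfps) u =
     (\<Sum>(v, w)\<in>monom_splits u. mfps_coeff f v * mfps_coeff g w)"
  by (simp add: times_mfps_def)

lemma mfps_coeff_const_mult [simp]:
  "mfps_coeff (mfps_const c * f :: 'a::comm_ring_1 mfps) u = c * mfps_coeff f u"
proof -
  have "mfps_coeff (mfps_const c * f) u =
      (\<Sum>p\<in>monom_splits u. if p = (0, u) then c * mfps_coeff f u else 0)"
    unfolding mfps_coeff_mult mfps_const_def mfps_coeff_MFPS
    by (rule sum.cong) (auto simp: monom_splits_def split: if_splits)
  also have "\<dots> = c * mfps_coeff f u"
    by (simp add: sum.delta) (simp add: monom_splits_def)
  finally show ?thesis .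
qed

text \<open>
  The product topology makes the ring operations continuous and the space regular. This is all that
  the interchange of iterated sums, \<open>has_sum_SigmaI\<close> and \<open>has_sum_SigmaD\<close>, requires, so that formal
  power series and complex numbers can be treated by the same lemmas.
\<close>

instance mfps :: (comm_ring_1) topological_comm_monoid_add
proof
  fix a b :: "'a mfps"
  show "((\<lambda>x. fst x + snd x) \<longlongrightarrow> a + b) (nhds a \<times>\<^sub>F nhds b)"
    unfolding tendsto_mfps_iff
  proof
    fix u
    have a: "\<forall>\<^sub>F x in nhds a. mfps_coeff x u = mfps_coeff a u"
      and b: "\<forall>\<^sub>F x in nhds b. mfps_coeff x u = mfps_coeff b u"
      using tendsto_mfps_iff[of "\<lambda>x. x" a "nhds a"] tendsto_mfps_iff[of "\<lambda>x. x" b "nhds b"]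
      by (auto simp: filterlim_ident)
    show "\<forall>\<^sub>F x in nhds a \<times>\<^sub>F nhds b.
        mfps_coeff (fst x + snd x) u = mfps_coeff (a + b) u"
      using eventually_prodI[OF a b] by eventually_elim auto
  qed
qed

instance mfps :: (comm_ring_1) topological_semigroup_mult
proof
  fix a b :: "'a mfps"
  show "((\<lambda>x. fst x * snd x) \<longlongrightarrow> a * b) (nhds a \<times>\<^sub>F nhds b)"
    unfolding tendsto_mfps_iff
  proof
    fix u
    let ?M = "monom_splits u"
    have ev: "\<forall>\<^sub>F x in nhds c. mfps_coeff x v = mfps_coeff c v" for c :: "'a mfps" and v
      using tendsto_mfps_iff[of "\<lambda>x. x" c "nhds c"] by (auto simp: filterlim_ident)
    have a: "\<forall>\<^sub>F x in nhds a. \<forall>p\<in>?M. mfps_coeff x (fst p) = mfps_coeff a (fst p)"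
      and b: "\<forall>\<^sub>F x in nhds b. \<forall>p\<in>?M. mfps_coeff x (snd p) = mfps_coeff b (snd p)"
      by (auto intro!: eventually_ball_finite ev)
    show "\<forall>\<^sub>F x in nhds a \<times>\<^sub>F nhds b.
        mfps_coeff (fst x * snd x) u = mfps_coeff (a * b) u"
      using eventually_prodI[OF a b]
      by eventually_elim (auto simp: mfps_coeff_mult intro!: sum.cong arg_cong2[of _ _ _ _ "(*)"])
  qed
qed

instance mfps :: (type) t3_space
proof
  fix S :: "'a mfps set" and y
  assume "closed S" "y \<notin> S"
  then obtain M where M: "finite M"
    and sub: "\<And>g. (\<forall>u\<in>M. mfps_coeff g u = mfps_coeff y u) \<Longrightarrow> g \<in> - S"
    unfolding closed_def open_mfps_def by blast
  let ?U = "{g. \<forall>u\<in>M. mfps_coeff g u = mfps_coeff y u}"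
  have "open ?U" "open (- ?U)"
    unfolding open_mfps_def using M by (auto intro!: exI[of _ M])
  then show "\<exists>U V. open U \<and> open V \<and> y \<in> U \<and> S \<subseteq> V \<and> U \<inter> V = {}"
    using sub by (intro exI[of _ ?U] exI[of _ "- ?U"]) auto
qed

text \<open>The total degree of a monomial.\<close>

definition monom_degree :: "(nat \<Rightarrow>\<^sub>0 nat) \<Rightarrow> nat"
  where "monom_degree u = (\<Sum>i\<in>Poly_Mapping.keys u. Poly_Mapping.lookup u i)"

lemma monom_degree_add: "monom_degree (v + w) = monom_degree v + monom_degree w"
proof -
  let ?K = "Poly_Mapping.keys v \<union> Poly_Mapping.keys w"
  have eq: "monom_degree u = (\<Sum>i\<in>?K. Poly_Mapping.lookup u i)"
    if "Poly_Mapping.keys u \<subseteq> ?K" for u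
    unfolding monom_degree_def using that
    by (intro sum.mono_neutral_left) (auto simp: in_keys_iff)
  show ?thesis
    using keys_add[of v w] by (simp add: eq lookup_add sum.distrib)
qed

lemma monom_degree_eq_0_iff [simp]: "monom_degree u = 0 \<longleftrightarrow> u = 0"
proof
  assume "monom_degree u = 0"
  then show "u = 0"
    by (intro poly_mapping_eqI) (auto simp: monom_degree_def in_keys_iff)
qed (simp add: monom_degree_def)

lemma monom_degree_single [simp]: "monom_degree (Poly_Mapping.single k n) = n"
  by (cases "n = 0") (auto simp: monom_degree_def)

text \<open>\<open>order_ge d f\<close>: the series \<open>f\<close> has no monomials of total degree below \<open>d\<close>.\<close>

definition order_ge :: "nat \<Rightarrow> 'a::zero mfps \<Rightarrow> bool"
  where "order_ge d f \<longleftrightarrow> (\<forall>u. monom_degree u < d \<longrightarrow> mfps_coeff f u = 0)"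

lemma order_ge_0 [simp]: "order_ge 0 f"
  by (simp add: order_ge_def)

lemma order_ge_1_iff: "order_ge 1 f \<longleftrightarrow> mfps_coeff f 0 = 0"
  by (auto simp: order_ge_def)

lemma order_ge_mono: "order_ge d f \<Longrightarrow> e \<le> d \<Longrightarrow> order_ge e f"
  by (auto simp: order_ge_def)

lemma order_ge_mult:
  fixes f g :: "'a::comm_ring_1 mfps"
  assumes f: "order_ge d f" and g: "order_ge e g"
  shows "order_ge (d + e) (f * g)"
  unfolding order_ge_def
proof (intro allI impI)
  fix u assume u: "monom_degree u < d + e"
  show "mfps_coeff (f * g) u = 0"
    unfolding mfps_coeff_mult
  proof (rule sum.neutral, clarify)
    fix v w assume "(v, w) \<in> monom_splits u"
    then have "monom_degree v < d \<or> monom_degree w < e"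
      using u by (auto simp: monom_splits_def monom_degree_add)
    then show "mfps_coeff f v * mfps_coeff g w = 0"
      using f g by (auto simp: order_ge_def)
  qed
qed

lemma order_ge_mult_left: "order_ge d g \<Longrightarrow> order_ge d (f * g)" for f g :: "'a::comm_ring_1 mfps"
  using order_ge_mult[of 0 f d g] by simp

lemma order_ge_power:
  fixes f :: "'a::comm_ring_1 mfps"
  assumes "order_ge d f"
  shows "order_ge (n * d) (f ^ n)"
  by (induction n) (auto intro: order_ge_mult assms)

text \<open>A family is summable as soon as the orders of its members tend to infinity.\<close>

lemma summable_on_mfps:
  fixes f :: "'b \<Rightarrow> 'a::comm_ring_1 mfps"
  assumes ord: "\<And>i. i \<in> A \<Longrightarrow> order_ge (d i) (f i)"
    and fin: "\<And>N. finite {i\<in>A. d i \<le> N}"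
  shows "f summable_on A"
proof -
  have "finite {i\<in>A. mfps_coeff (f i) u \<noteq> 0}" for u
  proof (rule finite_subset[OF _ fin])
    show "{i\<in>A. mfps_coeff (f i) u \<noteq> 0} \<subseteq> {i\<in>A. d i \<le> monom_degree u}"
      using ord by (auto simp: order_ge_def not_less[symmetric])
  qed
  then have "(f has_sum
      MFPS (\<lambda>u. \<Sum>i | i \<in> A \<and> mfps_coeff (f i) u \<noteq> 0. mfps_coeff (f i) u)) A"
    unfolding has_sum_mfps_iff by auto
  then show ?thesis
    by (rule has_sum_imp_summable)
qed

section \<open>Negative binomial series\<close>

text \<open>
  The expansion of \<open>(1 - y)^(-s)\<close> in a topological ring, with \<open>h = (1 - y)^(-1)\<close>; the term \<open>p = 0\<close>, which
  is \<open>1\<close>, is left out. If \<open>1 + B s\<close> is the full series, Pascal's rule gives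
  \<open>(1 - y) * (1 + B (s + 1)) = 1 + B s\<close>.
\<close>

lemma neg_binomial_has_sum:
  fixes y :: "'a::{comm_ring_1, topological_comm_monoid_add, topological_semigroup_mult, t2_space}"
  assumes summ: "\<And>s. (\<lambda>p. of_nat ((s + p - 1) choose p) * y ^ p) summable_on {1..}"
  shows "\<exists>h. (1 - y) * h = 1 \<and>
    (\<forall>s. ((\<lambda>p. of_nat ((s + p - 1) choose p) * y ^ p) has_sum (h ^ s - 1)) {1..})"
proof -
  define c :: "nat \<Rightarrow> nat \<Rightarrow> 'a" where "c = (\<lambda>s p. of_nat ((s + p - 1) choose p))"
  define B where "B s = (\<Sum>\<^sub>\<infinity>p\<in>{1..}. c s p * y ^ p)" for s
  have B: "((\<lambda>p. c s p * y ^ p) has_sum B s) {1..}" for s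
    unfolding B_def using summ by (auto simp: c_def)
  have nat: "UNIV = insert 0 {1::nat..}"
    by auto
  have B1: "((\<lambda>p. c s p * y ^ p) has_sum (1 + B s)) UNIV" for s
    unfolding nat using has_sum_insert[OF _ B, of 0 s] by (simp add: c_def)
  have B0: "B 0 = 0"
    unfolding B_def c_def by (rule infsum_0) (simp add: binomial_eq_0)
  have rec: "(1 - y) * (1 + B (Suc s)) = 1 + B s" for s
  proof -
    have "((\<lambda>p. y * (c (Suc s) p * y ^ p)) has_sum y * (1 + B (Suc s))) UNIV"
      by (rule has_sum_cmult_right[OF B1])
    then have "((\<lambda>p. c (Suc s) (p - 1) * y ^ p) has_sum y * (1 + B (Suc s))) (Suc ` UNIV)"
      by (subst has_sum_reindex) (auto simp: o_def mult.left_commute)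
    also have "Suc ` UNIV = {1..}"
      by (auto simp: image_iff Suc_le_eq gr0_conv_Suc)
    finally have "((\<lambda>p. c s p * y ^ p + c (Suc s) (p - 1) * y ^ p)
        has_sum (B s + y * (1 + B (Suc s)))) {1..}"
      by (intro has_sum_add B)
    also have "?this \<longleftrightarrow>
        ((\<lambda>p. c (Suc s) p * y ^ p) has_sum (B s + y * (1 + B (Suc s)))) {1..}"
    proof (rule has_sum_cong)
      fix p :: nat assume "p \<in> {1..}"
      then obtain q where q: "p = Suc q"
        by (cases p) auto
      show "c s p * y ^ p + c (Suc s) (p - 1) * y ^ p = c (Suc s) p * y ^ p"
        unfolding q c_def by (simp add: algebra_simps)
    qed
    finally have "B (Suc s) = B s + y * (1 + B (Suc s))"
      by (rule has_sum_unique[OF B])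
    then show ?thesis
      by (simp add: algebra_simps)
  qed
  define h where "h = 1 + B 1"
  have h: "(1 - y) * h = 1"
    using rec[of 0] B0 by (simp add: h_def)
  have "1 + B s = h ^ s" for s
  proof (induction s)
    case (Suc s)
    have "1 + B (Suc s) = (1 - y) * h * (1 + B (Suc s))"
      using h by simp
    also have "\<dots> = h * (1 + B s)"
      unfolding rec[of s, symmetric] by (simp only: ac_simps)
    finally show ?case
      using Suc by simp
  qed (simp add: B0)
  then have "B s = h ^ s - 1" for s
    by (simp add: eq_diff_eq add.commute)
  with B h show ?thesis
    by (intro exI[of _ h]) (auto simp: c_def)
qed

section \<open>Sums over multiindices, written as lists\<close>

text \<open>The multiindices of length at most \<open>L\<close>, the empty one included, as lists of positive numbers.\<close>

definition pos_lists :: "nat \<Rightarrow> nat list set"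
  where "pos_lists L = {ps. set ps \<subseteq> {1..} \<and> length ps \<le> L}"

text \<open>
  \<open>nb_weight s ps\<close> is the product of \<open>(m\<^sub>j + m\<^sub>j\<^sub>+\<^sub>1 - 1) choose m\<^sub>j\<^sub>+\<^sub>1\<close> over adjacent entries of the list
  \<open>s # ps\<close>; thus \<open>\<beta>(m)\<close> is the weight of the tail of \<open>m\<close> for \<open>s = m\<^sub>1\<close>. For \<open>s = 0\<close> it is \<open>1\<close> if \<open>ps\<close> is
  empty and \<open>0\<close> on all other lists of positive numbers.
\<close>

fun nb_weight :: "nat \<Rightarrow> nat list \<Rightarrow> nat" where
  "nb_weight s [] = 1"
| "nb_weight s (p # ps) = ((s + p - 1) choose p) * nb_weight p ps"

text \<open>The monomial \<open>w\<^sub>k\<close> to the first exponent, times \<open>w\<^sub>k\<^sub>+\<^sub>1\<close> to the second one, and so on.\<close>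

fun list_monom :: "(nat \<Rightarrow> 'a::monoid_mult) \<Rightarrow> nat \<Rightarrow> nat list \<Rightarrow> 'a" where
  "list_monom w k [] = 1"
| "list_monom w k (p # ps) = w k ^ p * list_monom w (Suc k) ps"

lemma pos_lists_0: "pos_lists 0 = {[]}"
  by (auto simp: pos_lists_def)

text \<open>The non-empty multiindices of length at most \<open>L\<close>.\<close>

definition ne_pos_lists :: "nat \<Rightarrow> nat list set"
  where "ne_pos_lists L = pos_lists L - {[]}"

lemma bij_betw_Cons_pos_lists:
  "bij_betw (\<lambda>(p, ps). p # ps) ({1..} \<times> pos_lists L) (ne_pos_lists (Suc L))"
proof (rule bij_betwI[where g = "\<lambda>ps. (hd ps, tl ps)"])
  show "(\<lambda>ps. (hd ps, tl ps)) \<in> ne_pos_lists (Suc L) \<rightarrow> {1..} \<times> pos_lists L"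
  proof
    fix ps assume "ps \<in> ne_pos_lists (Suc L)"
    then show "(hd ps, tl ps) \<in> {1..} \<times> pos_lists L"
      by (cases ps) (auto simp: ne_pos_lists_def pos_lists_def)
  qed
qed (auto simp: ne_pos_lists_def pos_lists_def)

text \<open>
  Summation over the entries after the first turns a sum over multiindices into a power series in
  \<open>w k * h\<close>, where \<open>h ^ p\<close> is the sum over the remaining entries if the first one is \<open>p\<close>. With
  \<open>c p = (s + p - 1) choose p\<close> this leads to the powers of a continued fraction, with \<open>c p = 1 / p\<close> to
  its logarithm.
\<close>

lemma has_sum_ne_pos_lists:
  fixes w :: "nat \<Rightarrow> 'a::{comm_ring_1, topological_comm_monoid_add, topological_semigroup_mult, t3_space}"
  assumes inner: "\<And>p. ((\<lambda>ps. of_nat (nb_weight p ps) * list_monom w (Suc k) ps) has_sum h ^ p)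
      (pos_lists L)"
    and outer: "((\<lambda>p. c p * (w k * h) ^ p) has_sum g) {1..}"
    and summ: "(\<lambda>ps. c (hd ps) * of_nat (nb_weight (hd ps) (tl ps)) * list_monom w k ps)
      summable_on ne_pos_lists (Suc L)"
  shows "((\<lambda>ps. c (hd ps) * of_nat (nb_weight (hd ps) (tl ps)) * list_monom w k ps)
      has_sum g) (ne_pos_lists (Suc L))"
proof -
  let ?f = "\<lambda>ps. c (hd ps) * of_nat (nb_weight (hd ps) (tl ps)) * list_monom w k ps"
  have "((\<lambda>q. ?f (case q of (p, ps) \<Rightarrow> p # ps)) has_sum g) ({1..} \<times> pos_lists L)"
  proof (rule has_sum_SigmaI)
    fix p :: nat
    show "((\<lambda>ps. ?f (case (p, ps) of (p, ps) \<Rightarrow> p # ps)) has_sum c p * (w k * h) ^ p) (pos_lists L)"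
      using has_sum_cmult_right[OF inner, of "c p * w k ^ p" p]
      by (simp add: ac_simps power_mult_distrib)
  next
    show "(\<lambda>q. ?f (case q of (p, ps) \<Rightarrow> p # ps)) summable_on {1..} \<times> pos_lists L"
      using summ summable_on_reindex_bij_betw[OF bij_betw_Cons_pos_lists, of ?f] by blast
  qed (rule outer)
  then show ?thesis
    using has_sum_reindex_bij_betw[OF bij_betw_Cons_pos_lists, of ?f] by blast
qed

lemma pos_lists_eq_insert: "pos_lists L = insert [] (ne_pos_lists L)"
  by (auto simp: ne_pos_lists_def pos_lists_def)

lemma nb_weight_Cons_split:
  "ps \<noteq> [] \<Longrightarrow> nb_weight s ps = ((s + hd ps - 1) choose hd ps) * nb_weight (hd ps) (tl ps)"
  by (cases ps) auto

text \<open>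
  The value of the continued fraction \<open>1 / (1 - w\<^sub>k / (1 - w\<^sub>k\<^sub>+\<^sub>1 / (\<dots>)))\<close> with \<open>L\<close> partial numerators,
  given as a sum over multiindices, which needs no division.
\<close>

definition cf_sum :: "(nat \<Rightarrow> 'a::{comm_ring_1, t2_space}) \<Rightarrow> nat \<Rightarrow> nat \<Rightarrow> 'a"
  where "cf_sum w k L = (\<Sum>\<^sub>\<infinity>ps\<in>pos_lists L. of_nat (nb_weight 1 ps) * list_monom w k ps)"

lemma cf_sum_0 [simp]: "cf_sum w k 0 = 1"
  by (simp add: cf_sum_def pos_lists_0)

text \<open>
  The induction step for two facts: the continued fraction recurrence, and the formula for all powers of
  the continued fraction as sums with weights \<open>nb_weight s\<close>. The formula for length \<open>L\<close> and all
  exponents is needed for both at length \<open>L + 1\<close>.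
\<close>

lemma cf_sum_step:
  fixes w :: "nat \<Rightarrow> 'a::{comm_ring_1, topological_comm_monoid_add, topological_semigroup_mult, t3_space}"
  assumes inner: "\<And>p. ((\<lambda>ps. of_nat (nb_weight p ps) * list_monom w (Suc k) ps) has_sum
      cf_sum w (Suc k) L ^ p) (pos_lists L)"
    and bin: "\<And>s. (\<lambda>p. of_nat ((s + p - 1) choose p) * (w k * cf_sum w (Suc k) L) ^ p)
      summable_on {1..}"
    and summ: "\<And>s. (\<lambda>ps. of_nat (nb_weight s ps) * list_monom w k ps)
      summable_on ne_pos_lists (Suc L)"
  shows "(1 - w k * cf_sum w (Suc k) L) * cf_sum w k (Suc L) = 1"
    and "((\<lambda>ps. of_nat (nb_weight s ps) * list_monom w k ps) has_sum
      cf_sum w k (Suc L) ^ s) (pos_lists (Suc L))"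
proof -
  obtain h where h: "(1 - w k * cf_sum w (Suc k) L) * h = 1"
    and bin': "\<And>s. ((\<lambda>p. of_nat ((s + p - 1) choose p) * (w k * cf_sum w (Suc k) L) ^ p)
      has_sum (h ^ s - 1)) {1..}"
    using neg_binomial_has_sum[OF bin] by auto
  have hs: "((\<lambda>ps. of_nat (nb_weight s ps) * list_monom w k ps) has_sum h ^ s) (pos_lists (Suc L))" for s
  proof -
    have eq: "of_nat ((s + hd ps - 1) choose hd ps) * of_nat (nb_weight (hd ps) (tl ps)) * list_monom w k ps
        = of_nat (nb_weight s ps) * list_monom w k ps"
      if "ps \<in> ne_pos_lists (Suc L)" for ps
      using that by (subst nb_weight_Cons_split[of ps s]) (auto simp: ne_pos_lists_def)
    have "((\<lambda>ps. of_nat ((s + hd ps - 1) choose hd ps) * of_nat (nb_weight (hd ps) (tl ps))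
         * list_monom w k ps) has_sum (h ^ s - 1)) (ne_pos_lists (Suc L))"
      by (rule has_sum_ne_pos_lists[OF inner bin'], subst summable_on_cong[OF eq]) (auto intro: summ)
    then have "((\<lambda>ps. of_nat (nb_weight s ps) * list_monom w k ps) has_sum (h ^ s - 1)) (ne_pos_lists (Suc L))"
      by (subst (asm) has_sum_cong[OF eq]) auto
    moreover have "[] \<notin> ne_pos_lists (Suc L)"
      by (simp add: ne_pos_lists_def)
    ultimately show ?thesis
      using has_sum_insert[of "[]" "ne_pos_lists (Suc L)"] by (force simp: pos_lists_eq_insert)
  qed
  have "cf_sum w k (Suc L) = h"
    unfolding cf_sum_def using hs[of 1] by (simp add: infsumI)
  with h hs show "(1 - w k * cf_sum w (Suc k) L) * cf_sum w k (Suc L) = 1"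
    and "((\<lambda>ps. of_nat (nb_weight s ps) * list_monom w k ps) has_sum
      cf_sum w k (Suc L) ^ s) (pos_lists (Suc L))"
    by simp_all
qed

text \<open>
  The products of the denominators of the continued fractions satisfy the three-term recurrence
  of \<open>\<FF>\<close>.
\<close>

lemma cf_sum_prod:
  fixes w :: "nat \<Rightarrow> 'a::{comm_ring_1, t2_space}"
  assumes cf: "\<And>k. k < n \<Longrightarrow> (1 - w k * cf_sum w (Suc k) (n - Suc k)) * cf_sum w k (n - k) = 1"
    and "k < n"
  defines "P \<equiv> \<lambda>k. \<Prod>i = k..<n. 1 - w i * cf_sum w (Suc i) (n - Suc i)"
  shows "P k = P (k + 1) - w k * P (k + 2)"
proof -
  have P: "P i = (1 - w i * cf_sum w (Suc i) (n - Suc i)) * P (Suc i)" if "i < n" for i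
    using that unfolding P_def by (simp add: prod.atLeast_Suc_lessThan)
  have "cf_sum w (Suc k) (n - Suc k) * P (Suc k) = P (Suc (Suc k))"
  proof (cases "Suc k < n")
    case True
    have "cf_sum w (Suc k) (n - Suc k) * P (Suc k) =
        ((1 - w (Suc k) * cf_sum w (Suc (Suc k)) (n - Suc (Suc k))) * cf_sum w (Suc k) (n - Suc k)) * P (Suc (Suc k))"
      unfolding P[OF True] by (simp only: ac_simps)
    then show ?thesis
      by (simp only: cf[OF True] mult_1_left)
  next
    case False
    then show ?thesis
      by (simp add: P_def)
  qed
  then show ?thesis
    using P[OF \<open>k < n\<close>] by (simp add: algebra_simps)
qed

text \<open>The coefficient \<open>\<alpha>(m)\<close>, for a non-empty multiindex given as a list.\<close>

definition log_weight :: "nat list \<Rightarrow> 'a::field_char_0"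
  where "log_weight ps = 1 / of_nat (hd ps) * of_nat (nb_weight (hd ps) (tl ps))"

section \<open>Estimates\<close>

lemma summable_on_neg_binomial_real:
  fixes y :: real
  assumes "0 \<le> y" "y < 1"
  shows "(\<lambda>p. of_nat ((s + p - 1) choose p) * y ^ p) summable_on {1..}"
proof -
  have "((- real s) gchoose p) * (- y) ^ p = of_nat ((s + p - 1) choose p) * y ^ p" for p
  proof (cases p)
    case (Suc q)
    have "((- real s) gchoose p) = (-1) ^ p * of_nat ((s + p - 1) choose p)"
      by (simp add: gbinomial_minus binomial_gbinomial Suc)
    then show ?thesis
      by (simp flip: power_mult_distrib)
  qed simp
  moreover have "summable (\<lambda>p. ((- real s) gchoose p) * (- y) ^ p)"
    using gen_binomial_real[of "- y" "- real s"] assms by (auto simp: sums_iff)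
  ultimately have "(\<lambda>p. of_nat ((s + p - 1) choose p) * y ^ p) summable_on UNIV"
    using assms by (intro summable_nonneg_imp_summable_on) auto
  then show ?thesis
    by (rule summable_on_subset) auto
qed

lemma summable_on_neg_binomial_complex:
  fixes y :: complex
  assumes "norm y < 1"
  shows "(\<lambda>p. of_nat ((s + p - 1) choose p) * y ^ p) summable_on {1..}"
  by (rule abs_summable_summable)
     (use summable_on_neg_binomial_real[of "norm y" s] assms in \<open>simp add: norm_mult norm_power\<close>)

lemma has_sum_log_complex:
  fixes y :: complex
  assumes y: "norm y < 1"
  shows "((\<lambda>p. 1 / of_nat p * y ^ p) has_sum (- Ln (1 - y))) {1..}"
proof -
  have eq: "- ((- 1) ^ Suc p / of_nat p * (- y) ^ p) = 1 / of_nat p * y ^ p" for p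
    by (simp flip: power_mult_distrib)
  have s: "(\<lambda>p. 1 / of_nat p * y ^ p) sums (- Ln (1 - y))"
    using sums_minus[OF Ln_series[of "- y"]] y unfolding eq by simp
  have "summable (\<lambda>p. norm y ^ p)"
    using y by (intro summable_geometric) simp
  then have "summable (\<lambda>p. norm (1 / of_nat p * y ^ p))"
  proof (rule summable_comparison_test'[where N = 0])
    fix p :: nat
    show "norm (norm (1 / of_nat p * y ^ p)) \<le> norm y ^ p"
      by (cases "p = 0") (auto simp: norm_mult norm_power norm_divide divide_simps mult_le_cancel_left1)
  qed
  then have "((\<lambda>p. 1 / of_nat p * y ^ p) has_sum (- Ln (1 - y))) UNIV"
    using s by (rule norm_summable_imp_has_sum)
  then show ?thesis
    by (rule has_sum_cong_neutral[THEN iffD1, rotated -1]) auto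
qed

lemma has_sum_log_real:
  fixes y :: real
  assumes "0 \<le> y" "y < 1"
  shows "((\<lambda>p. 1 / of_nat p * y ^ p) has_sum (- ln (1 - y))) {1..}"
proof -
  have "((\<lambda>p. of_real (1 / of_nat p * y ^ p)) has_sum (of_real (- ln (1 - y)) :: complex)) {1..}"
    using has_sum_log_complex[of "of_real y"] assms by (simp flip: Ln_of_real)
  then show ?thesis
    by (simp only: has_sum_of_real_iff)
qed

lemma list_monom_nonneg: "(\<And>k. (0::real) \<le> w k) \<Longrightarrow> 0 \<le> list_monom w k ps"
  by (induction ps arbitrary: k) auto

lemma list_monom_norm:
  fixes v :: "nat \<Rightarrow> 'a::real_normed_field"
  shows "norm (list_monom v k ps) = list_monom (\<lambda>i. norm (v i)) k ps"
  by (induction ps arbitrary: k) (auto simp: norm_mult norm_power)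

lemma summable_on_ne_pos_lists_real:
  fixes w :: "nat \<Rightarrow> real"
  assumes w: "\<And>i. 0 \<le> w i" and c: "\<And>p. 0 \<le> c p"
    and inner: "\<And>p. ((\<lambda>ps. of_nat (nb_weight p ps) * list_monom w (Suc k) ps) has_sum h ^ p)
      (pos_lists L)"
    and outer: "(\<lambda>p. c p * (w k * h) ^ p) summable_on {1..}"
  shows "(\<lambda>ps. c (hd ps) * of_nat (nb_weight (hd ps) (tl ps)) * list_monom w k ps)
      summable_on ne_pos_lists (Suc L)"
proof -
  let ?f = "\<lambda>ps. c (hd ps) * of_nat (nb_weight (hd ps) (tl ps)) * list_monom w k ps"
  have "(\<lambda>q. ?f (case q of (p, ps) \<Rightarrow> p # ps)) summable_on ({1..} \<times> pos_lists L)"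
  proof (rule summable_on_SigmaI)
    fix p :: nat
    show "((\<lambda>ps. ?f (case (p, ps) of (p, ps) \<Rightarrow> p # ps)) has_sum c p * (w k * h) ^ p) (pos_lists L)"
      using has_sum_cmult_right[OF inner, of "c p * w k ^ p" p]
      by (simp add: ac_simps power_mult_distrib)
  next
    fix p :: nat and ps :: "nat list"
    show "0 \<le> ?f (case (p, ps) of (p, ps) \<Rightarrow> p # ps)"
      using w c by (auto intro!: mult_nonneg_nonneg list_monom_nonneg)
  qed (rule outer)
  then show ?thesis
    using summable_on_reindex_bij_betw[OF bij_betw_Cons_pos_lists, of ?f] by blast
qed

text \<open>
  For nonnegative \<open>w\<close> whose sum is below \<open>1\<close> the continued fractions converge. The bound by the ratio
  of two values of \<open>1 - sum w\<close> keeps \<open>w k * cf_sum w (Suc k) (L - 1)\<close> below \<open>1\<close> in the induction, and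
  it makes the sum of the logarithms telescope later on.
\<close>

lemma cf_sum_real:
  fixes w :: "nat \<Rightarrow> real"
  assumes w: "\<And>i. 0 \<le> w i" and less: "sum w {k..<k + L} < 1"
  shows "0 \<le> cf_sum w k L \<and>
    cf_sum w k L \<le> (1 - sum w {Suc k..<k + L}) / (1 - sum w {k..<k + L}) \<and>
    (\<forall>s. ((\<lambda>ps. of_nat (nb_weight s ps) * list_monom w k ps) has_sum cf_sum w k L ^ s)
       (pos_lists L)) \<and>
    (L > 0 \<longrightarrow> w k * cf_sum w (Suc k) (L - 1) < 1 \<and>
       (1 - w k * cf_sum w (Suc k) (L - 1)) * cf_sum w k L = 1)"
  using less
proof (induction L arbitrary: k)
  case 0
  then show ?case
    by (auto simp: pos_lists_0 intro!: has_sum_finiteI)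
next
  case (Suc L)
  let ?h = "cf_sum w (Suc k) L"
  define t where "t = 1 - sum w {Suc k..<Suc k + L}"
  have split: "sum w {k..<k + Suc L} = w k + sum w {Suc k..<Suc k + L}"
    by (simp add: sum.atLeast_Suc_lessThan)
  have t: "w k < t" "0 < t"
    using Suc.prems split w[of k] unfolding t_def by linarith+
  have IH: "0 \<le> ?h" "?h \<le> (1 - sum w {Suc (Suc k)..<Suc k + L}) / t"
    and inner: "((\<lambda>ps. of_nat (nb_weight s ps) * list_monom w (Suc k) ps) has_sum ?h ^ s) (pos_lists L)" for s
    using Suc.IH[of "Suc k"] t unfolding t_def by auto
  have "?h \<le> 1 / t"
    using IH(2) t sum_nonneg[of "{Suc (Suc k)..<Suc k + L}" w] w
    by (meson diff_le_eq divide_right_mono le_add_same_cancel1 less_imp_le order_trans)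
  then have yle: "w k * ?h \<le> w k / t"
    using w[of k] mult_left_mono[of ?h "1 / t" "w k"] by simp
  moreover have "w k / t < 1"
    using t by simp
  ultimately have "w k * ?h < 1"
    by (rule order_le_less_trans)
  with w[of k] IH(1) have y: "0 \<le> w k * ?h" "w k * ?h < 1"
    by (simp_all only: mult_nonneg_nonneg)
  have bin: "(\<lambda>p. of_nat ((s + p - 1) choose p) * (w k * ?h) ^ p) summable_on {1..}" for s
    by (rule summable_on_neg_binomial_real[OF y])
  have summ: "(\<lambda>ps. of_nat (nb_weight s ps) * list_monom w k ps) summable_on ne_pos_lists (Suc L)" for s
  proof -
    have "(\<lambda>ps. real ((s + hd ps - 1) choose hd ps) * of_nat (nb_weight (hd ps) (tl ps)) * list_monom w k ps)
        summable_on ne_pos_lists (Suc L)"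
      by (rule summable_on_ne_pos_lists_real[OF w _ inner bin]) auto
    then show ?thesis
      by (rule summable_on_cong[THEN iffD1, rotated])
         (simp add: nb_weight_Cons_split[of _ s] ne_pos_lists_def)
  qed
  note step = cf_sum_step[OF inner bin summ]
  have nz: "0 < 1 - w k * ?h"
    using y by simp
  have cf: "cf_sum w k (Suc L) = 1 / (1 - w k * ?h)"
    using step(1) nz by (simp add: field_simps)
  have "1 / (1 - w k * ?h) \<le> 1 / (1 - w k / t)"
    using yle nz t by (intro divide_left_mono mult_pos_pos) auto
  also have "\<dots> = t / (t - w k)"
    using t by (simp add: field_simps)
  finally have le: "cf_sum w k (Suc L) \<le> t / (t - w k)"
    unfolding cf .
  have eq: "t / (t - w k) = (1 - sum w {Suc k..<k + Suc L}) / (1 - sum w {k..<k + Suc L})"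
    unfolding split t_def by (simp add: algebra_simps)
  show ?case
    using le nz step y(2) unfolding eq by (auto simp: cf)
qed

text \<open>The complex case, by comparison with the absolute values.\<close>

lemma cf_sum_complex:
  fixes v :: "nat \<Rightarrow> complex"
  defines "w \<equiv> \<lambda>i. norm (v i)"
  assumes less: "sum w {k..<k + L} < 1"
  shows "norm (cf_sum v k L) \<le> cf_sum w k L \<and>
    (\<forall>s. ((\<lambda>ps. of_nat (nb_weight s ps) * list_monom v k ps) has_sum cf_sum v k L ^ s)
       (pos_lists L)) \<and>
    (L > 0 \<longrightarrow> norm (v k * cf_sum v (Suc k) (L - 1)) < 1 \<and>
       (1 - v k * cf_sum v (Suc k) (L - 1)) * cf_sum v k L = 1)"
  using less
proof (induction L arbitrary: k)
  case 0
  then show ?case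
    by (auto simp: pos_lists_0 intro!: has_sum_finiteI)
next
  case (Suc L)
  let ?h = "cf_sum v (Suc k) L"
  have w: "0 \<le> w i" for i
    by (simp add: w_def)
  have "sum w {Suc k..<Suc k + L} \<le> sum w {k..<k + Suc L}"
    by (intro sum_mono2) (auto simp: w)
  then have IH: "norm ?h \<le> cf_sum w (Suc k) L"
    and inner: "((\<lambda>ps. of_nat (nb_weight s ps) * list_monom v (Suc k) ps) has_sum ?h ^ s) (pos_lists L)" for s
    using Suc.IH[of "Suc k"] Suc.prems by auto
  note R = cf_sum_real[of w, OF w Suc.prems]
  have "norm (v k * ?h) \<le> w k * cf_sum w (Suc k) L"
    using IH by (simp add: norm_mult w_def mult_left_mono)
  also have "\<dots> < 1"
    using R by simp
  finally have y: "norm (v k * ?h) < 1" .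
  have bin: "(\<lambda>p. of_nat ((s + p - 1) choose p) * (v k * ?h) ^ p) summable_on {1..}" for s
    by (rule summable_on_neg_binomial_complex[OF y])
  have norm_eq: "norm (of_nat (nb_weight s ps) * list_monom v k ps) = of_nat (nb_weight s ps) * list_monom w k ps" for s ps
    by (simp add: norm_mult list_monom_norm w_def)
  have Rs: "(\<lambda>ps. of_nat (nb_weight s ps) * list_monom w k ps) summable_on pos_lists (Suc L)" for s
    using R by (blast intro: has_sum_imp_summable)
  have "(\<lambda>ps. of_nat (nb_weight s ps) * list_monom v k ps) summable_on pos_lists (Suc L)" for s
    by (rule abs_summable_summable) (simp only: norm_eq Rs)
  then have summ: "(\<lambda>ps. of_nat (nb_weight s ps) * list_monom v k ps) summable_on ne_pos_lists (Suc L)" for s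
    by (rule summable_on_subset) (auto simp: ne_pos_lists_def)
  note step = cf_sum_step[OF inner bin summ]
  have "norm (cf_sum v k (Suc L)) \<le> cf_sum w k (Suc L)"
    unfolding cf_sum_def norm_eq[symmetric]
    by (rule norm_infsum_bound) (simp only: norm_eq Rs)
  then show ?case
    using step y by simp
qed

lemma log_list_sum_real:
  fixes w :: "nat \<Rightarrow> real"
  assumes w: "\<And>i. 0 \<le> w i" and less: "sum w {k..<k + Suc L} < 1"
  shows "\<exists>g. ((\<lambda>ps. log_weight ps * list_monom w k ps) has_sum g) (ne_pos_lists (Suc L)) \<and>
    g \<le> ln (1 - sum w {Suc k..<k + Suc L}) - ln (1 - sum w {k..<k + Suc L})"
proof -
  have "sum w {Suc k..<k + Suc L} \<le> sum w {k..<k + Suc L}"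
    by (intro sum_mono2) (auto simp: w)
  then have less': "sum w {Suc k..<Suc k + L} < 1"
    using less by simp
  let ?h = "cf_sum w (Suc k) L"
  have y: "0 \<le> w k * ?h" "w k * ?h < 1"
    and cf: "(1 - w k * ?h) * cf_sum w k (Suc L) = 1"
    and le: "cf_sum w k (Suc L) \<le> (1 - sum w {Suc k..<k + Suc L}) / (1 - sum w {k..<k + Suc L})"
    and inner: "((\<lambda>ps. of_nat (nb_weight s ps) * list_monom w (Suc k) ps) has_sum ?h ^ s) (pos_lists L)" for s
    using cf_sum_real[of w, OF w less] cf_sum_real[of w, OF w less'] w by auto
  note outer = has_sum_log_real[OF y]
  have "(\<lambda>ps. log_weight ps * list_monom w k ps) summable_on ne_pos_lists (Suc L)"
    unfolding log_weight_def
    by (rule summable_on_ne_pos_lists_real[OF w _ inner has_sum_imp_summable[OF outer]]) auto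
  then have "((\<lambda>ps. log_weight ps * list_monom w k ps) has_sum (- ln (1 - w k * ?h))) (ne_pos_lists (Suc L))"
    unfolding log_weight_def by (rule has_sum_ne_pos_lists[OF inner outer])
  moreover have cf': "cf_sum w k (Suc L) = inverse (1 - w k * ?h)"
    using inverse_unique[OF cf] by simp
  then have "- ln (1 - w k * ?h) = ln (cf_sum w k (Suc L))"
    using y by (simp add: ln_inverse)
  moreover have "cf_sum w k (Suc L) > 0"
    unfolding cf' using y by simp
  then have "ln (cf_sum w k (Suc L)) \<le> ln ((1 - sum w {Suc k..<k + Suc L}) / (1 - sum w {k..<k + Suc L}))"
    using le by (subst ln_le_cancel_iff) auto
  ultimately show ?thesis
    using less less' by (auto simp: ln_div)
qed

lemma log_list_sum_complex:
  fixes v :: "nat \<Rightarrow> complex"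
  assumes less: "(\<Sum>i=k..<k + Suc L. norm (v i)) < 1"
  shows "((\<lambda>ps. log_weight ps * list_monom v k ps) has_sum (- Ln (1 - v k * cf_sum v (Suc k) L)))
    (ne_pos_lists (Suc L))"
proof -
  have "(\<Sum>i=Suc k..<k + Suc L. norm (v i)) \<le> (\<Sum>i=k..<k + Suc L. norm (v i))"
    by (intro sum_mono2) auto
  then have less': "(\<Sum>i=Suc k..<Suc k + L. norm (v i)) < 1"
    using less by simp
  let ?h = "cf_sum v (Suc k) L"
  have y: "norm (v k * ?h) < 1"
    and inner: "((\<lambda>ps. of_nat (nb_weight s ps) * list_monom v (Suc k) ps) has_sum ?h ^ s) (pos_lists L)" for s
    using cf_sum_complex[OF less] cf_sum_complex[OF less'] by auto
  have norm_eq: "norm (log_weight ps * list_monom v k ps) = log_weight ps * list_monom (\<lambda>i. norm (v i)) k ps" for ps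
    by (simp add: norm_mult norm_divide list_monom_norm log_weight_def)
  have "(\<lambda>ps. log_weight ps * list_monom v k ps) summable_on ne_pos_lists (Suc L)"
    by (rule abs_summable_summable, unfold norm_eq)
       (use log_list_sum_real[OF _ less] in \<open>auto intro: has_sum_imp_summable\<close>)
  then show ?thesis
    unfolding log_weight_def by (rule has_sum_ne_pos_lists[OF inner has_sum_log_complex[OF y]])
qed

section \<open>The recurrence for \<open>\<FF>\<close>\<close>

text \<open>
  The iterated sum over \<open>k\<^sub>1 \<ge> a, k\<^sub>2 \<ge> k\<^sub>1 + 2, \<dots>, k\<^sub>m \<ge> k\<^sub>m\<^sub>-\<^sub>1 + 2\<close> of \<open>w k\<^sub>1 * \<dots> * w k\<^sub>m\<close>. Unlike \<open>F_nested\<close>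
  it has no accumulated factor.
\<close>

fun nested_sum :: "(nat \<Rightarrow> 'a::{comm_ring_1, t2_space}) \<Rightarrow> nat \<Rightarrow> nat \<Rightarrow> 'a" where
  "nested_sum w 0 a = 1"
| "nested_sum w (Suc m) a = (\<Sum>\<^sub>\<infinity>k\<in>{a..}. w k * nested_sum w m (k + 2))"

text \<open>
  \<open>\<FF>\<close> of the sequence without its first \<open>a - 1\<close> terms, as a function of the products
  \<open>w k = x k * x (k + 1)\<close>.
\<close>

definition F_tail :: "(nat \<Rightarrow> 'a::{comm_ring_1, t2_space}) \<Rightarrow> nat \<Rightarrow> 'a"
  where "F_tail w a = 1 + (\<Sum>\<^sub>\<infinity>m\<in>{1..}. (- 1) ^ m * nested_sum w m a)"

lemma F_nested_eq:
  fixes x :: "nat \<Rightarrow> 'a::{comm_ring_1, topological_semigroup_mult, t2_space}"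
  assumes w: "\<And>k. w k = x k * x (k + 1)"
    and summ: "\<And>m a. 1 \<le> a \<Longrightarrow> (\<lambda>k. w k * nested_sum w m (k + 2)) summable_on {a..}"
    and "1 \<le> a"
  shows "F_nested x m a p = p * nested_sum w m a"
  using \<open>1 \<le> a\<close>
proof (induction m arbitrary: a p)
  case (Suc m)
  have "F_nested x (Suc m) a p = (\<Sum>\<^sub>\<infinity>k\<in>{a..}. p * (w k * nested_sum w m (k + 2)))"
    unfolding F_nested.simps
  proof (rule infsum_cong)
    fix k assume "k \<in> {a..}"
    then show "F_nested x m (k + 2) (p * x k * x (k + 1)) = p * (w k * nested_sum w m (k + 2))"
      using Suc by (simp add: w[of k] mult.assoc)
  qed
  also have "\<dots> = p * nested_sum w (Suc m) a"
    using summ[OF Suc.prems] by (simp add: infsum_cmult_right)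
  finally show ?case .
qed simp

lemma F_fun_eq_F_tail:
  fixes x :: "nat \<Rightarrow> 'a::{comm_ring_1, topological_semigroup_mult, t2_space}"
  assumes w: "\<And>k. w k = x k * x (k + 1)"
    and summ: "\<And>m a. 1 \<le> a \<Longrightarrow> (\<lambda>k. w k * nested_sum w m (k + 2)) summable_on {a..}"
  shows "F_fun x = F_tail w 1"
  unfolding F_fun_def F_tail_def using F_nested_eq[OF w summ, of 1 _ 1] by simp

text \<open>The terms with \<open>k\<^sub>1 = a\<close> contribute \<open>- w a * F_tail w (a + 2)\<close>, all others \<open>F_tail w (a + 1)\<close>.\<close>

lemma F_tail_rec:
  fixes w :: "nat \<Rightarrow> 'a::{comm_ring_1, topological_comm_monoid_add, topological_semigroup_mult, t2_space}"
  assumes summ: "\<And>m a. 1 \<le> a \<Longrightarrow> (\<lambda>k. w k * nested_sum w m (k + 2)) summable_on {a..}"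
    and summ': "\<And>a. 1 \<le> a \<Longrightarrow> (\<lambda>m. (- 1) ^ m * nested_sum w m a) summable_on {1..}"
    and a: "1 \<le> a"
  shows "F_tail w a = F_tail w (a + 1) - w a * F_tail w (a + 2)"
proof -
  let ?g = "\<lambda>b m. (- 1) ^ m * nested_sum w m b"
  have nat: "UNIV = insert 0 {1::nat..}" "{1..} = Suc ` UNIV"
    by (auto simp: image_iff Suc_le_eq gr0_conv_Suc)
  have g1: "(?g b has_sum (F_tail w b - 1)) {1..}" if "1 \<le> b" for b
    using summ'[OF that] by (simp add: F_tail_def)
  have g: "(?g b has_sum F_tail w b) UNIV" if "1 \<le> b" for b
    unfolding nat(1) using has_sum_insert[OF _ g1[OF that], of 0] by simp
  have gS: "((\<lambda>m. ?g b (Suc m)) has_sum (F_tail w b - 1)) UNIV" if "1 \<le> b" for b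
    using g1[OF that] unfolding nat(2) by (subst (asm) has_sum_reindex) (auto simp: o_def)
  have split: "nested_sum w (Suc m) a = w a * nested_sum w m (a + 2) + nested_sum w (Suc m) (a + 1)" for m
  proof -
    have "{a..} = insert a {a + 1..}"
      by auto
    then show ?thesis
      using infsum_insert[OF summ[of "a + 1" m], of a] by simp
  qed
  have "((\<lambda>m. - w a * ?g (a + 2) m + ?g (a + 1) (Suc m)) has_sum
      (- w a * F_tail w (a + 2) + (F_tail w (a + 1) - 1))) UNIV"
    by (intro has_sum_add has_sum_cmult_right g gS) auto
  also have "(\<lambda>m. - w a * ?g (a + 2) m + ?g (a + 1) (Suc m)) = (\<lambda>m. ?g a (Suc m))"
    unfolding split by (simp add: algebra_simps)
  finally have "F_tail w a - 1 = - w a * F_tail w (a + 2) + (F_tail w (a + 1) - 1)"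
    using gS[OF a] has_sum_unique by blast
  then show ?thesis
    by (simp add: algebra_simps)
qed

text \<open>If \<open>w\<close> vanishes from \<open>n\<close> on, then all sums involved are finite.\<close>

lemma nested_sum_finite:
  fixes w :: "nat \<Rightarrow> 'a::{comm_ring_1, topological_comm_monoid_add, topological_semigroup_mult, t2_space}"
  assumes w: "\<And>k. n \<le> k \<Longrightarrow> w k = 0"
  shows "(\<lambda>k. w k * nested_sum w m (k + 2)) summable_on {a..}"
    and "n < Suc m + a \<Longrightarrow> nested_sum w (Suc m) a = 0"
    and "(\<lambda>m. (- 1) ^ m * nested_sum w m a) summable_on {1..}"
proof -
  have fin: "finite {k\<in>{a..}. w k * z k \<noteq> 0}" for a and z :: "nat \<Rightarrow> 'a"
    by (rule finite_subset[of _ "{..<n}"]) (auto simp: not_le[symmetric] w)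
  show "(\<lambda>k. w k * nested_sum w m (k + 2)) summable_on {a..}"
    by (rule finite_nonzero_values_imp_summable_on[OF fin])
  have 0: "nested_sum w (Suc m) a = 0" if "n < Suc m + a" for m a
    using that
  proof (induction m arbitrary: a)
    case 0
    then show ?case
      by (auto simp: w intro!: infsum_0)
  next
    case (Suc m)
    then show ?case
      by (subst nested_sum.simps) (auto intro!: infsum_0)
  qed
  then show "n < Suc m + a \<Longrightarrow> nested_sum w (Suc m) a = 0" .
  have "{m\<in>{1..}. (- 1) ^ m * nested_sum w m a \<noteq> 0} \<subseteq> {..n}"
  proof
    fix m assume m: "m \<in> {m\<in>{1..}. (- 1) ^ m * nested_sum w m a \<noteq> 0}"
    then obtain q where "m = Suc q"
      by (cases m) auto
    then show "m \<in> {..n}"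
      using m 0[of q a] by (cases "m \<le> n") auto
  qed
  then show "(\<lambda>m. (- 1) ^ m * nested_sum w m a) summable_on {1..}"
    by (intro finite_nonzero_values_imp_summable_on) (auto intro: finite_subset)
qed

lemma F_tail_beyond:
  fixes w :: "nat \<Rightarrow> 'a::{comm_ring_1, topological_comm_monoid_add, topological_semigroup_mult, t2_space}"
  assumes w: "\<And>k. n \<le> k \<Longrightarrow> w k = 0" and "n \<le> a"
  shows "F_tail w a = 1"
proof -
  have "(- 1) ^ m * nested_sum w m a = 0" if m: "m \<in> {1..}" for m
  proof -
    obtain q where "m = Suc q"
      using m by (cases m) auto
    then show ?thesis
      using nested_sum_finite(2)[of n w q a] assms by auto
  qed
  then have "(\<Sum>\<^sub>\<infinity>m\<in>{1..}. (- 1) ^ m * nested_sum w m a) = 0"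
    by (rule infsum_0)
  then show ?thesis
    by (simp add: F_tail_def)
qed

lemma F_fun_finite_eq_prod:
  fixes x :: "nat \<Rightarrow> 'a::{comm_ring_1, topological_comm_monoid_add, topological_semigroup_mult, t2_space}"
  assumes w: "\<And>k. w k = x k * x (k + 1)" and zero: "\<And>k. n \<le> k \<Longrightarrow> w k = 0"
    and cf: "\<And>k. k < n \<Longrightarrow> (1 - w k * cf_sum w (Suc k) (n - Suc k)) * cf_sum w k (n - k) = 1"
    and "1 \<le> n"
  shows "F_fun x = (\<Prod>i = 1..<n. 1 - w i * cf_sum w (Suc i) (n - Suc i))"
proof -
  let ?P = "\<lambda>k. \<Prod>i = k..<n. 1 - w i * cf_sum w (Suc i) (n - Suc i)"
  note fin = nested_sum_finite[of n w, OF zero]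
  have "F_tail w k = ?P k \<and> F_tail w (k + 1) = ?P (k + 1)" if "1 \<le> k" "k \<le> n" for k
    using that(2,1)
  proof (induction k rule: inc_induct)
    case base
    then show ?case
      using F_tail_beyond[of n w, OF zero] by simp
  next
    case (step k)
    then have "F_tail w k = F_tail w (k + 1) - w k * F_tail w (k + 2)"
      by (intro F_tail_rec fin) auto
    then show ?case
      using step cf_sum_prod[of n w k, OF cf] by simp
  qed
  moreover have "F_fun x = F_tail w 1"
    by (rule F_fun_eq_F_tail[OF w fin(1)])
  ultimately show ?thesis
    using \<open>1 \<le> n\<close> by simp
qed

section \<open>Convergence of the finite sections\<close>

lemma finite_subset_UN_mono:
  fixes A :: "nat \<Rightarrow> 'b set"
  assumes A: "mono A" and X: "finite X" "X \<subseteq> (\<Union>n. A n)"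
  shows "\<exists>n. X \<subseteq> A n"
  using X
proof (induction X rule: finite_induct)
  case (insert i X)
  then obtain n m where "X \<subseteq> A n" "i \<in> A m"
    by auto
  then have "insert i X \<subseteq> A (max n m)"
    using monoD[OF A, of n "max n m"] monoD[OF A, of m "max n m"] by auto
  then show ?case ..
qed auto

text \<open>Absolutely convergent sums are limits along any increasing exhaustion of the index set.\<close>

lemma infsum_exhaust:
  fixes f :: "'b \<Rightarrow> 'a::banach"
  assumes f: "(\<lambda>i. norm (f i)) summable_on B"
    and A: "mono A" "(\<Union>n. A n) = B"
  shows "(\<lambda>n. infsum f (A n)) \<longlonglongrightarrow> infsum f B"
proof (rule LIMSEQ_I)
  fix r :: real assume r: "0 < r"
  let ?g = "\<lambda>i. norm (f i)"
  have sub: "A n \<subseteq> B" for n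
    using A by auto
  obtain X where X: "finite X" "X \<subseteq> B" "dist (sum ?g X) (infsum ?g B) \<le> r / 2"
    using infsum_finite_approximation[OF f, of "r / 2"] r by auto
  have "\<exists>n. X \<subseteq> A n"
    by (rule finite_subset_UN_mono) (use A X in auto)
  then obtain N where N: "X \<subseteq> A N" ..
  show "\<exists>no. \<forall>n\<ge>no. norm (infsum f (A n) - infsum f B) < r"
  proof (intro exI allI impI)
    fix n assume "N \<le> n"
    then have XA: "X \<subseteq> A n"
      using N A(1) by (auto dest: monoD)
    have B: "B = A n \<union> (B - A n)"
      using sub by auto
    have sA: "?g summable_on A n" and sB: "?g summable_on (B - A n)"
      using f sub by (auto intro: summable_on_subset)
    have "infsum f B = infsum f (A n) + infsum f (B - A n)"
      by (subst B, rule infsum_Un_disjoint) (auto intro: abs_summable_summable sA sB)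
    then have "norm (infsum f (A n) - infsum f B) \<le> infsum ?g (B - A n)"
      using norm_infsum_bound[OF sB] by simp
    also have "infsum ?g B = infsum ?g (A n) + infsum ?g (B - A n)"
      by (subst B, rule infsum_Un_disjoint) (auto intro: sA sB)
    then have "infsum ?g (B - A n) = infsum ?g B - infsum ?g (A n)"
      by simp
    also have "sum ?g X \<le> infsum ?g (A n)"
      by (rule finite_sum_le_infsum[OF sA X(1) XA]) auto
    then have "infsum ?g B - infsum ?g (A n) \<le> r / 2"
      using X(3) unfolding dist_real_def abs_le_iff by linarith
    finally show "norm (infsum f (A n) - infsum f B) < r"
      using r by simp
  qed
qed

text \<open>
  For complex \<open>w\<close> with \<open>T a\<close> the sum of \<open>norm (w k)\<close> over \<open>k \<ge> a\<close>, the \<open>m\<close>-fold sum from \<open>a\<close> on is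
  bounded by \<open>T a ^ m\<close>. As \<open>T a\<close> is below \<open>1\<close> and tends to \<open>0\<close>, the series \<open>F_tail w a\<close> converges for
  all \<open>a \<ge> 1\<close>, and it tends to \<open>1\<close>.
\<close>

context
  fixes w :: "nat \<Rightarrow> complex"
  assumes summ: "(\<lambda>k. norm (w k)) summable_on {1..}"
    and less: "(\<Sum>\<^sub>\<infinity>k\<in>{1..}. norm (w k)) < 1"
begin

private abbreviation (input) "T \<equiv> \<lambda>a. \<Sum>\<^sub>\<infinity>k\<in>{a..}. norm (w k)"

lemma tail_summable: "1 \<le> a \<Longrightarrow> (\<lambda>k. norm (w k)) summable_on {a..}"
  by (rule summable_on_subset[OF summ]) auto

lemma tail_antimono: "1 \<le> a \<Longrightarrow> a \<le> b \<Longrightarrow> T b \<le> T a"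
  by (rule infsum_mono2) (auto intro: tail_summable)

lemma tail_nonneg: "0 \<le> T a"
  by (rule infsum_nonneg) auto

lemma tail_less_1: "1 \<le> a \<Longrightarrow> T a < 1"
  using tail_antimono[of 1 a] less by simp

lemma tail_tendsto_0: "T \<longlonglongrightarrow> 0"
proof -
  have "(\<lambda>n. \<Sum>\<^sub>\<infinity>k\<in>{1..<n}. norm (w k)) \<longlonglongrightarrow> T 1"
    by (rule infsum_exhaust) (use summ in \<open>auto simp: mono_def\<close>)
  from tendsto_diff[OF tendsto_const this, of "T 1"]
  have lim: "(\<lambda>n. T 1 - (\<Sum>k=1..<n. norm (w k))) \<longlonglongrightarrow> 0"
    by simp
  have "\<forall>\<^sub>F n in sequentially. T 1 - (\<Sum>k=1..<n. norm (w k)) = T n"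
    using eventually_ge_at_top[of 1]
  proof eventually_elim
    case (elim n)
    then have "{1..} = {1..<n} \<union> {n..}"
      by auto
    moreover have "infsum (\<lambda>k. norm (w k)) ({1..<n} \<union> {n..}) = (\<Sum>k=1..<n. norm (w k)) + T n"
      using infsum_Un_disjoint[of "\<lambda>k. norm (w k)" "{1..<n}" "{n..}"] tail_summable[OF elim]
      by (simp add: ivl_disj_int)
    ultimately have "T 1 = (\<Sum>k=1..<n. norm (w k)) + T n"
      by simp
    then show ?case
      by simp
  qed
  from Lim_transform_eventually[OF lim this] show ?thesis .
qed

lemma nested_sum_complex:
  assumes "1 \<le> a"
  shows "(\<lambda>k. norm (w k * nested_sum w m (k + 2))) summable_on {a..} \<and>
    norm (nested_sum w m a) \<le> T a ^ m"
  using assms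
proof (induction m arbitrary: a)
  case 0
  then show ?case
    using tail_summable by simp
next
  case (Suc m)
  have step: "(\<lambda>k. norm (w k * nested_sum w j (k + 2))) summable_on {b..} \<and>
      (\<Sum>\<^sub>\<infinity>k\<in>{b..}. norm (w k * nested_sum w j (k + 2))) \<le> T b ^ Suc j"
    if b: "1 \<le> b" and IH: "\<And>a. 1 \<le> a \<Longrightarrow> norm (nested_sum w j a) \<le> T a ^ j" for j b
  proof -
    have le: "norm (w k * nested_sum w j (k + 2)) \<le> T b ^ j * norm (w k)" if "k \<in> {b..}" for k
    proof -
      have "norm (nested_sum w j (k + 2)) \<le> T (k + 2) ^ j"
        using IH b that by auto
      also have "\<dots> \<le> T b ^ j"
        using b that by (intro power_mono tail_antimono tail_nonneg) auto
      finally show ?thesis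
        by (simp add: norm_mult mult.commute mult_left_mono)
    qed
    have s: "(\<lambda>k. T b ^ j * norm (w k)) summable_on {b..}"
      by (intro summable_on_cmult_right tail_summable b)
    have s': "(\<lambda>k. norm (w k * nested_sum w j (k + 2))) summable_on {b..}"
      by (rule summable_on_comparison_test[OF s]) (use le in auto)
    have "(\<Sum>\<^sub>\<infinity>k\<in>{b..}. norm (w k * nested_sum w j (k + 2))) \<le> (\<Sum>\<^sub>\<infinity>k\<in>{b..}. T b ^ j * norm (w k))"
      by (rule infsum_mono[OF s' s le])
    also have "\<dots> = T b ^ Suc j"
      by (simp add: infsum_cmult_right')
    finally show ?thesis
      using s' by simp
  qed
  have bound: "norm (nested_sum w (Suc m) b) \<le> T b ^ Suc m" if "1 \<le> b" for b
  proof -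
    have "norm (nested_sum w (Suc m) b) \<le> (\<Sum>\<^sub>\<infinity>k\<in>{b..}. norm (w k * nested_sum w m (k + 2)))"
      using norm_infsum_bound[of "\<lambda>k. w k * nested_sum w m (k + 2)" "{b..}"] step[of b m] Suc.IH that by simp
    also have "\<dots> \<le> T b ^ Suc m"
      using step[of b m] Suc.IH that by blast
    finally show ?thesis .
  qed
  then show ?case
    using step[of a "Suc m"] Suc.prems by blast
qed

lemma F_tail_complex:
  assumes "1 \<le> a"
  shows "(\<lambda>m. norm ((- 1) ^ m * nested_sum w m a)) summable_on {1..} \<and>
    norm (F_tail w a - 1) \<le> T a / (1 - T a)"
proof -
  have geo: "((\<lambda>m. T a ^ m) has_sum (T a / (1 - T a))) {1..}"
    using has_sum_geometric_from_1[of "T a"] tail_nonneg[of a] tail_less_1[OF assms] by simp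
  have le: "norm ((- 1) ^ m * nested_sum w m a) \<le> T a ^ m" for m
    using nested_sum_complex[OF assms, of m] by (simp add: norm_mult norm_power)
  have s: "(\<lambda>m. norm ((- 1) ^ m * nested_sum w m a)) summable_on {1..}"
    by (rule summable_on_comparison_test[OF has_sum_imp_summable[OF geo]]) (use le in auto)
  have "norm (F_tail w a - 1) \<le> (\<Sum>\<^sub>\<infinity>m\<in>{1..}. norm ((- 1) ^ m * nested_sum w m a))"
    unfolding F_tail_def using norm_infsum_bound[OF s] by simp
  also have "\<dots> \<le> (\<Sum>\<^sub>\<infinity>m\<in>{1..}. T a ^ m)"
    by (rule infsum_mono[OF s has_sum_imp_summable[OF geo] le])
  also have "\<dots> = T a / (1 - T a)"
    by (rule infsumI[OF geo])
  finally show ?thesis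
    using s by blast
qed

lemma F_tail_tendsto: "F_tail w \<longlonglongrightarrow> 1"
proof -
  have "(\<lambda>a. T a / (1 - T a)) \<longlonglongrightarrow> 0 / (1 - 0)"
    by (intro tendsto_intros tail_tendsto_0) auto
  then have "(\<lambda>a. T a / (1 - T a)) \<longlonglongrightarrow> 0"
    by simp
  then have "(\<lambda>a. F_tail w a - 1) \<longlonglongrightarrow> 0"
    by (rule Lim_null_comparison[rotated])
       (use F_tail_complex in \<open>auto intro!: eventually_sequentiallyI[of 1]\<close>)
  then show ?thesis
    by (simp add: LIM_zero_iff)
qed

lemma sum_norm_le: "1 \<le> a \<Longrightarrow> sum (\<lambda>k. norm (w k)) {a..<b} \<le> T 1"
  by (rule finite_sum_le_infsum[OF summ]) auto

text \<open>
  The product on the left and \<open>F_tail w\<close> satisfy the same recurrence, the former with initial values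
  \<open>1\<close> at \<open>n\<close> and \<open>n + 1\<close>. The error at \<open>1\<close> is at most the error at \<open>n\<close> and \<open>n + 1\<close> times the product
  of all \<open>1 + norm (w i)\<close>, which is bounded.
\<close>

lemma prod_tendsto_F_tail:
  "(\<lambda>n. \<Prod>i = 1..<n. 1 - w i * cf_sum w (Suc i) (n - Suc i)) \<longlonglongrightarrow> F_tail w 1"
proof -
  define P where "P n k = (\<Prod>i = k..<n. 1 - w i * cf_sum w (Suc i) (n - Suc i))" for n k
  define \<epsilon> where "\<epsilon> n = norm (F_tail w n - 1) + norm (F_tail w (Suc n) - 1)" for n
  have P: "P n k = P n (k + 1) - w k * P n (k + 2)" if "1 \<le> k" "k < n" for n k
  proof -
    \<comment> \<open>The value \<open>w 0\<close> is arbitrary; it is replaced by \<open>0\<close> to have the identities from index \<open>0\<close> on.\<close>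
    let ?w = "\<lambda>i. if i = 0 then 0 else w i"
    have cf_eq: "cf_sum w j L = cf_sum ?w j L" if "1 \<le> j" for j L
    proof -
      have "list_monom w j ps = list_monom ?w j ps" for ps
        using that by (induction ps arbitrary: j) auto
      then show ?thesis
        by (simp add: cf_sum_def)
    qed
    have P_eq: "P n j = (\<Prod>i = j..<n. 1 - ?w i * cf_sum ?w (Suc i) (n - Suc i))" if "1 \<le> j" for j
      unfolding P_def
    proof (rule prod.cong[OF refl])
      fix i assume "i \<in> {j..<n}"
      then show "1 - w i * cf_sum w (Suc i) (n - Suc i) = 1 - ?w i * cf_sum ?w (Suc i) (n - Suc i)"
        using that cf_eq[of "Suc i"] by simp
    qed
    have cf: "(1 - ?w j * cf_sum ?w (Suc j) (n - Suc j)) * cf_sum ?w j (n - j) = 1" if "j < n" for j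
    proof -
      have "(\<Sum>i = j..<j + (n - j). norm (?w i)) = (\<Sum>i = max 1 j..<n. norm (w i))"
        using that by (intro sum.mono_neutral_cong_right) auto
      also have "\<dots> < 1"
        using sum_norm_le[of "max 1 j" n] less by simp
      finally show ?thesis
        using cf_sum_complex[of ?w j "n - j"] that by simp
    qed
    show ?thesis
      using cf_sum_prod[of n ?w k, OF cf] that P_eq[of k] P_eq[of "k + 1"] P_eq[of "k + 2"] by simp
  qed
  have rec: "F_tail w k = F_tail w (k + 1) - w k * F_tail w (k + 2)" if "1 \<le> k" for k
    by (rule F_tail_rec[OF _ _ that])
       (use nested_sum_complex F_tail_complex in \<open>blast intro: abs_summable_summable\<close>)+
  have bound: "norm (F_tail w k - P n k) \<le> \<epsilon> n * (\<Prod>i = k..<n. 1 + norm (w i)) \<and>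
      norm (F_tail w (k + 1) - P n (k + 1)) \<le> \<epsilon> n * (\<Prod>i = k..<n. 1 + norm (w i))"
    if "1 \<le> k" "k \<le> n" for n k
    using that(2,1)
  proof (induction k rule: inc_induct)
    case base
    then show ?case
      by (simp add: P_def \<epsilon>_def)
  next
    case (step k)
    let ?E = "\<epsilon> n * (\<Prod>i = Suc k..<n. 1 + norm (w i))"
    have E: "0 \<le> ?E"
      by (auto simp: \<epsilon>_def intro!: mult_nonneg_nonneg prod_nonneg)
    have IH: "norm (F_tail w (k + 1) - P n (k + 1)) \<le> ?E" "norm (F_tail w (k + 2) - P n (k + 2)) \<le> ?E"
      using step by auto
    have eq: "\<epsilon> n * (\<Prod>i = k..<n. 1 + norm (w i)) = ?E + norm (w k) * ?E"
      using step by (simp add: prod.atLeast_Suc_lessThan algebra_simps)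
    have "F_tail w k - P n k = (F_tail w (k + 1) - P n (k + 1)) - w k * (F_tail w (k + 2) - P n (k + 2))"
      using rec[of k] P[of k n] step by (simp add: algebra_simps)
    also have "norm \<dots> \<le> norm (F_tail w (k + 1) - P n (k + 1)) + norm (w k * (F_tail w (k + 2) - P n (k + 2)))"
      by (rule norm_triangle_ineq4)
    also have "\<dots> \<le> ?E + norm (w k) * ?E"
      unfolding norm_mult by (intro add_mono mult_left_mono IH) auto
    finally show ?case
      unfolding eq using IH(1) E by (simp add: add_increasing2)
  qed
  have prod_le: "(\<Prod>i = 1..<n. 1 + norm (w i)) \<le> exp 1" for n
  proof -
    have "(\<Prod>i = 1..<n. 1 + norm (w i)) \<le> (\<Prod>i = 1..<n. exp (norm (w i)))"
      by (intro prod_mono) (auto intro: add_nonneg_nonneg)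
    also have "\<dots> = exp (\<Sum>i = 1..<n. norm (w i))"
      by (simp add: exp_sum)
    also have "\<dots> \<le> exp 1"
      using sum_norm_le[of 1 n] less by simp
    finally show ?thesis .
  qed
  have "\<epsilon> \<longlonglongrightarrow> norm (1 - 1 :: complex) + norm (1 - 1 :: complex)"
    unfolding \<epsilon>_def by (intro tendsto_intros F_tail_tendsto LIMSEQ_Suc[OF F_tail_tendsto])
  from tendsto_mult_right[OF this, of "exp 1"] have lim: "(\<lambda>n. \<epsilon> n * exp 1) \<longlonglongrightarrow> 0"
    by simp
  have "(\<lambda>n. P n 1 - F_tail w 1) \<longlonglongrightarrow> 0"
  proof (rule Lim_null_comparison[OF _ lim], rule eventually_sequentiallyI[of 1])
    fix n :: nat assume "1 \<le> n"
    then have "norm (P n 1 - F_tail w 1) \<le> \<epsilon> n * (\<Prod>i = 1..<n. 1 + norm (w i))"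
      using bound[of 1 n] by (simp add: norm_minus_commute)
    also have "\<dots> \<le> \<epsilon> n * exp 1"
      using prod_le by (intro mult_left_mono) (auto simp: \<epsilon>_def)
    finally show "norm (P n 1 - F_tail w 1) \<le> \<epsilon> n * exp 1" .
  qed
  then show ?thesis
    by (simp add: P_def LIM_zero_iff)
qed

end

section \<open>Multiindices as lists\<close>

text \<open>The non-empty multiindices of arbitrary length.\<close>

definition all_pos_lists :: "nat list set"
  where "all_pos_lists = {ps. set ps \<subseteq> {1..} \<and> ps \<noteq> []}"

text \<open>The list \<open>[m 1, \<dots>, m l]\<close> of a multiindex.\<close>

definition list_of :: "nat \<Rightarrow> (nat \<Rightarrow> nat) \<Rightarrow> nat list"
  where "list_of l m = map m [1..<Suc l]"

lemma length_list_of [simp]: "length (list_of l m) = l"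
  by (simp add: list_of_def)

lemma nth_list_of [simp]: "j < l \<Longrightarrow> list_of l m ! j = m (Suc j)"
  by (simp add: list_of_def del: upt_Suc)

lemma bij_betw_list_of:
  "bij_betw (list_of l) (multiindices l) {ps. set ps \<subseteq> {1..} \<and> length ps = l}"
proof (rule bij_betwI[where g = "\<lambda>ps. restrict (\<lambda>j. ps ! (j - 1)) {1..l}"])
  show "list_of l \<in> multiindices l \<rightarrow> {ps. set ps \<subseteq> {1..} \<and> length ps = l}"
    by (auto simp: list_of_def multiindices_def PiE_def Pi_def simp del: upt_Suc)
  show "(\<lambda>ps. restrict (\<lambda>j. ps ! (j - 1)) {1..l}) \<in> {ps. set ps \<subseteq> {1..} \<and> length ps = l} \<rightarrow> multiindices l"
  proof
    fix ps :: "nat list" assume ps: "ps \<in> {ps. set ps \<subseteq> {1..} \<and> length ps = l}"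
    have "1 \<le> ps ! (j - 1)" if "j \<in> {1..l}" for j
    proof -
      have "ps ! (j - 1) \<in> set ps"
        using ps that by (intro nth_mem) auto
      then show ?thesis
        using ps by auto
    qed
    then show "restrict (\<lambda>j. ps ! (j - 1)) {1..l} \<in> multiindices l"
      by (auto simp: multiindices_def)
  qed
next
  fix m assume "m \<in> multiindices l"
  then show "restrict (\<lambda>j. list_of l m ! (j - 1)) {1..l} = m"
    by (intro ext) (auto simp: multiindices_def PiE_def extensional_def restrict_def)
next
  fix ps :: "nat list" assume "ps \<in> {ps. set ps \<subseteq> {1..} \<and> length ps = l}"
  then show "list_of l (restrict (\<lambda>j. ps ! (j - 1)) {1..l}) = ps"
    by (intro nth_equalityI) auto
qed

lemma bij_betw_list_of_Sigma:
  "bij_betw (\<lambda>(l, m). list_of l m) (Sigma {1..n} multiindices) (ne_pos_lists n)" (is ?fin)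
  "bij_betw (\<lambda>(l, m). list_of l m) (Sigma {1..} multiindices) all_pos_lists" (is ?inf)
proof -
  have inj: "inj_on (\<lambda>(l, m). list_of l m) (Sigma UNIV multiindices)"
  proof (rule inj_onI, clarsimp)
    fix l m l' m' assume m: "m \<in> multiindices l" "m' \<in> multiindices l'"
      and eq: "list_of l m = list_of l' m'"
    have "l = l'"
      using arg_cong[OF eq, of length] by simp
    then show "l = l' \<and> m = m'"
      using m eq bij_betw_imp_inj_on[OF bij_betw_list_of, of l] by (auto dest: inj_onD)
  qed
  have img: "list_of l ` multiindices l = {ps. set ps \<subseteq> {1..} \<and> length ps = l}" for l
    using bij_betw_list_of by (rule bij_betw_imp_surj_on)
  have Sig: "(\<lambda>(l, m). list_of l m) ` Sigma A multiindices = (\<Union>l\<in>A. list_of l ` multiindices l)" for A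
    by (auto simp: image_iff)
  show ?fin
    unfolding bij_betw_def Sig img
    by (auto intro: inj_on_subset[OF inj] simp: ne_pos_lists_def pos_lists_def Suc_le_eq)
  show ?inf
    unfolding bij_betw_def Sig img
    by (auto intro: inj_on_subset[OF inj] simp: all_pos_lists_def Suc_le_eq)
qed

lemma list_monom_eq_prod: "list_monom w k ps = (\<Prod>j<length ps. w (k + j) ^ (ps ! j))"
  for w :: "nat \<Rightarrow> 'a::comm_monoid_mult"
  by (induction ps arbitrary: k) (simp_all add: prod.lessThan_Suc_shift del: prod.lessThan_Suc)

lemma list_monom_list_of:
  "list_monom (\<lambda>i. x i * x (i + 1)) k (list_of l m) = (\<Prod>j = 1..l. (x (k + j - 1) * x (k + j)) ^ m j)"
  for x :: "nat \<Rightarrow> 'a::comm_ring_1"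
  unfolding list_monom_eq_prod length_list_of
  by (rule prod.reindex_bij_witness[of _ "\<lambda>j. j - 1" Suc]) auto

lemma nb_weight_eq_prod:
  "nb_weight s ps = (\<Prod>j<length ps. ((s # ps) ! j + ps ! j - 1) choose (ps ! j))"
  by (induction ps arbitrary: s) (simp_all add: prod.lessThan_Suc_shift del: prod.lessThan_Suc)

lemma log_weight_list_of:
  assumes "1 \<le> l"
  shows "log_weight (list_of l m) = alpha_coeff l m"
proof -
  obtain l' where l: "l = Suc l'"
    using assms by (cases l) auto
  have tl: "list_of l m = m 1 # map m [2..<Suc l]"
    unfolding list_of_def using assms by (simp add: upt_conv_Cons numeral_2_eq_2 del: upt_Suc)
  have "nb_weight (m 1) (map m [2..<Suc l]) = beta_coeff l m"
    unfolding nb_weight_eq_prod beta_coeff_def tl[symmetric]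
    by (rule prod.reindex_bij_witness[of _ "\<lambda>j. j - 1" Suc])
       (auto simp: l numeral_2_eq_2 simp del: upt_Suc)
  then show ?thesis
    unfolding log_weight_def alpha_coeff_def by (simp add: tl)
qed

lemma nb_weight_pos: "1 \<le> s \<Longrightarrow> set ps \<subseteq> {1..} \<Longrightarrow> 0 < nb_weight s ps"
  by (induction ps arbitrary: s) (auto intro: Suc_leI)

lemma log_weight_nonzero: "ps \<in> all_pos_lists \<Longrightarrow> (log_weight ps :: 'a::field_char_0) \<noteq> 0"
  using nb_weight_pos[of "hd ps" "tl ps"]
  by (cases ps) (auto simp: log_weight_def all_pos_lists_def)

section \<open>The logarithm of \<open>\<FF>\<close> for complex sequences\<close>

text \<open>
  The pairs of a starting index \<open>k\<close> and a multiindex whose monomial only involves \<open>w\<^sub>k, \<dots>, w\<^sub>n\<^sub>-\<^sub>1\<close>,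
  that is, \<open>x\<^sub>k, \<dots>, x\<^sub>n\<close>.
\<close>

definition index_set :: "nat \<Rightarrow> (nat \<times> nat list) set"
  where "index_set n = Sigma {1..<n} (\<lambda>k. ne_pos_lists (n - k))"

lemma index_set_exhaust: "mono index_set" "(\<Union>n. index_set n) = {1..} \<times> all_pos_lists"
proof -
  show "mono index_set"
    by (auto simp: mono_def index_set_def ne_pos_lists_def pos_lists_def)
  have "(k, ps) \<in> index_set (k + Suc (length ps))" if "(k, ps) \<in> {1..} \<times> all_pos_lists" for k ps
    using that by (auto simp: index_set_def ne_pos_lists_def pos_lists_def all_pos_lists_def)
  then have "{1..} \<times> all_pos_lists \<subseteq> (\<Union>n. index_set n)"
    by blast
  moreover have "(\<Union>n. index_set n) \<subseteq> {1..} \<times> all_pos_lists"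
    by (auto simp: index_set_def ne_pos_lists_def pos_lists_def all_pos_lists_def)
  ultimately show "(\<Union>n. index_set n) = {1..} \<times> all_pos_lists"
    by blast
qed

text \<open>
  For nonnegative \<open>w\<close> the partial sums over \<open>index_set n\<close> are uniformly bounded, because the bounds of
  \<open>log_list_sum_real\<close> telescope.
\<close>

lemma log_family_summable_real:
  fixes w :: "nat \<Rightarrow> real"
  assumes w: "\<And>k. 0 \<le> w k" and le: "\<And>n. sum w {1..<n} \<le> \<sigma>" and less: "\<sigma> < 1"
  shows "(\<lambda>(k, ps). log_weight ps * list_monom w k ps) summable_on {1..} \<times> all_pos_lists \<and>
    (\<Sum>\<^sub>\<infinity>(k, ps)\<in>{1..} \<times> all_pos_lists. log_weight ps * list_monom w k ps) \<le> - ln (1 - \<sigma>)"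
proof -
  let ?f = "\<lambda>(k, ps). log_weight ps * list_monom w k ps"
  have nonneg: "0 \<le> ?f q" for q
    by (cases q) (auto simp: log_weight_def intro!: divide_nonneg_nonneg mult_nonneg_nonneg list_monom_nonneg[of w, OF w])
  have fin: "?f summable_on index_set n \<and> infsum ?f (index_set n) \<le> - ln (1 - \<sigma>)" for n
  proof -
    have "\<exists>g. ((\<lambda>ps. ?f (k, ps)) has_sum g) (ne_pos_lists (n - k)) \<and>
        g \<le> ln (1 - sum w {Suc k..<n}) - ln (1 - sum w {k..<n})" if k: "k \<in> {1..<n}" for k
    proof -
      have "sum w {k..<n} \<le> sum w {1..<n}"
        using k by (intro sum_mono2) (auto simp: w)
      also have "\<dots> < 1"
        using le[of n] less by simp
      finally have "sum w {k..<k + Suc (n - Suc k)} < 1"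
        using k by simp
      note * = log_list_sum_real[of w, OF w this]
      have nk: "Suc (n - Suc k) = n - k" "k + (n - k) = n"
        using k by auto
      show ?thesis
        using * unfolding nk prod.case .
    qed
    then obtain g where g: "\<And>k. k \<in> {1..<n} \<Longrightarrow> ((\<lambda>ps. ?f (k, ps)) has_sum g k) (ne_pos_lists (n - k))"
      and gle: "\<And>k. k \<in> {1..<n} \<Longrightarrow> g k \<le> ln (1 - sum w {Suc k..<n}) - ln (1 - sum w {k..<n})"
      by metis
    have summ: "?f summable_on index_set n"
      unfolding index_set_def by (rule summable_on_SigmaI[OF g]) (use nonneg in auto)
    have "(?f has_sum sum g {1..<n}) (index_set n)"
      unfolding index_set_def
      by (rule has_sum_SigmaI[OF g]) (use summ in \<open>auto simp: index_set_def intro: has_sum_finiteI\<close>)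
    then have "infsum ?f (index_set n) = sum g {1..<n}"
      by (rule infsumI)
    also have "\<dots> \<le> (\<Sum>k = 1..<n. ln (1 - sum w {Suc k..<n}) - ln (1 - sum w {k..<n}))"
      by (intro sum_mono gle)
    also have "\<dots> \<le> - ln (1 - sum w {1..<n})"
    proof (cases "1 \<le> n")
      case True
      then show ?thesis
        by (subst sum_Suc_diff'[of 1 n "\<lambda>k. ln (1 - sum w {k..<n})"]) auto
    qed auto
    also have "\<dots> \<le> - ln (1 - \<sigma>)"
      using le[of n] less by simp
    finally show ?thesis
      using summ by blast
  qed
  have bound: "sum ?f X \<le> - ln (1 - \<sigma>)" if X: "finite X" "X \<subseteq> {1..} \<times> all_pos_lists" for X
  proof -
    have "\<exists>n. X \<subseteq> index_set n"
      by (rule finite_subset_UN_mono[OF index_set_exhaust(1) X(1)])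
         (simp only: index_set_exhaust(2) X(2))
    then obtain n where n: "X \<subseteq> index_set n" ..
    have "sum ?f X \<le> infsum ?f (index_set n)"
      by (rule finite_sum_le_infsum[OF conjunct1[OF fin] X(1) n nonneg])
    then show ?thesis
      using fin[of n] by simp
  qed
  have summ: "?f summable_on {1..} \<times> all_pos_lists"
    by (rule nonneg_bdd_above_summable_on) (use bound nonneg in \<open>auto intro!: bdd_aboveI2\<close>)
  moreover have "infsum ?f ({1..} \<times> all_pos_lists) \<le> - ln (1 - \<sigma>)"
    by (rule infsum_le_finite_sums[OF summ bound])
  ultimately show ?thesis
    by simp
qed

text \<open>Any bound below \<open>pi\<close> would do to identify the branch of the logarithm.\<close>

lemma ln2_bound: "- ln (1 - ln 2) < (2 :: real)"
proof -
  have "1 / 4 \<le> 1 - ln (2 :: real)"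
    using ln2_le_25_over_36 by simp
  then have "ln (1 / 4) \<le> ln (1 - ln (2::real))"
    by (subst ln_le_cancel_iff) auto
  moreover have "ln (1 / 4 :: real) = - (2 * ln 2)"
    using ln_realpow[of 2 2] by (simp add: ln_div)
  moreover have "ln 2 < (1 :: real)"
    using ln2_le_25_over_36 by simp
  ultimately show ?thesis
    by simp
qed

text \<open>
  With \<open>S\<close> the sum of the family, \<open>exp (- S) = \<FF>(x)\<close> is the limit of the corresponding identities for
  \<open>index_set n\<close>, and \<open>norm S < pi\<close> makes \<open>- S\<close> the principal logarithm.
\<close>

lemma Ln_F_fun:
  fixes x :: "nat \<Rightarrow> complex"
  assumes x: "x \<in> D_space" and less: "(\<Sum>\<^sub>\<infinity>k\<in>{1..}. norm (x k * x (k + 1))) < ln 2"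
  defines "w \<equiv> \<lambda>k. x k * x (k + 1)"
  defines "f \<equiv> \<lambda>(k, ps). log_weight ps * list_monom w k ps"
  shows "f summable_on {1..} \<times> all_pos_lists \<and> Ln (F_fun x) = - infsum f ({1..} \<times> all_pos_lists)"
proof -
  let ?B = "{1..} \<times> all_pos_lists"
  let ?\<sigma> = "\<Sum>\<^sub>\<infinity>k\<in>{1..}. norm (w k)"
  have summ: "(\<lambda>k. norm (w k)) summable_on {1..}"
    using x by (simp add: D_space_def w_def)
  have less1: "?\<sigma> < 1"
    using less ln2_le_25_over_36 by (simp add: w_def)
  have le: "(\<Sum>k = 1..<n. norm (w k)) \<le> ?\<sigma>" for n
    by (rule finite_sum_le_infsum[OF summ]) auto
  have norm_f: "norm (f q) = (case q of (k, ps) \<Rightarrow> log_weight ps * list_monom (\<lambda>i. norm (w i)) k ps)" for q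
    by (simp add: f_def norm_mult norm_divide list_monom_norm log_weight_def case_prod_beta)
  have R: "(\<lambda>q. norm (f q)) summable_on ?B" "infsum (\<lambda>q. norm (f q)) ?B \<le> - ln (1 - ?\<sigma>)"
    unfolding norm_f using log_family_summable_real[of "\<lambda>k. norm (w k)", OF _ le less1] by auto
  define S where "S = infsum f ?B"
  have "norm S \<le> - ln (1 - ?\<sigma>)"
    unfolding S_def using norm_infsum_bound[OF R(1)] R(2) by simp
  also have "\<dots> \<le> - ln (1 - ln 2)"
    using less ln2_le_25_over_36 by (simp add: w_def)
  also have "\<dots> < 2"
    by (rule ln2_bound)
  finally have normS: "norm S < 2" .
  have lim: "(\<lambda>n. infsum f (index_set n)) \<longlonglongrightarrow> S"
    unfolding S_def by (rule infsum_exhaust[OF R(1) index_set_exhaust])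
  have exp_eq: "exp (- infsum f (index_set n)) = (\<Prod>i = 1..<n. 1 - w i * cf_sum w (Suc i) (n - Suc i))" for n
  proof -
    have less_k: "(\<Sum>i=k..<k + Suc (n - Suc k). norm (w i)) < 1" if "k \<in> {1..<n}" for k
    proof -
      have "(\<Sum>i=k..<n. norm (w i)) \<le> (\<Sum>i=1..<n. norm (w i))"
        using that by (intro sum_mono2) auto
      then show ?thesis
        using that le[of n] less1 by simp
    qed
    have inner: "((\<lambda>ps. f (k, ps)) has_sum (- Ln (1 - w k * cf_sum w (Suc k) (n - Suc k))))
        (ne_pos_lists (n - k))" if "k \<in> {1..<n}" for k
      using log_list_sum_complex[OF less_k[OF that]] that by (simp add: f_def Suc_diff_Suc)
    have "f summable_on index_set n"
      by (rule abs_summable_summable, rule summable_on_subset[OF R(1)])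
         (use index_set_exhaust(2) in auto)
    then have "(f has_sum (\<Sum>k = 1..<n. - Ln (1 - w k * cf_sum w (Suc k) (n - Suc k)))) (index_set n)"
      unfolding index_set_def by (intro has_sum_SigmaI[OF inner]) (auto intro: has_sum_finiteI)
    then have "exp (- infsum f (index_set n)) = (\<Prod>k = 1..<n. exp (Ln (1 - w k * cf_sum w (Suc k) (n - Suc k))))"
      by (simp add: infsumI sum_negf exp_sum)
    also have "\<dots> = (\<Prod>k = 1..<n. 1 - w k * cf_sum w (Suc k) (n - Suc k))"
    proof (rule prod.cong[OF refl])
      fix k assume "k \<in> {1..<n}"
      then have "norm (w k * cf_sum w (Suc k) (n - Suc k)) < 1"
        using cf_sum_complex[OF less_k] by simp
      then show "exp (Ln (1 - w k * cf_sum w (Suc k) (n - Suc k))) = 1 - w k * cf_sum w (Suc k) (n - Suc k)"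
        by (intro exp_Ln) auto
    qed
    finally show ?thesis .
  qed
  have "(\<lambda>n. exp (- infsum f (index_set n))) \<longlonglongrightarrow> exp (- S)"
    by (intro tendsto_intros lim)
  then have "F_tail w 1 = exp (- S)"
    unfolding exp_eq using prod_tendsto_F_tail[OF summ less1] LIMSEQ_unique by blast
  moreover have "F_fun x = F_tail w 1"
    by (rule F_fun_eq_F_tail)
       (use nested_sum_complex[OF summ less1] in \<open>auto simp: w_def intro: abs_summable_summable\<close>)
  ultimately have "F_fun x = exp (- S)"
    by simp
  moreover have "\<bar>Im (- S)\<bar> < pi"
    using abs_Im_le_cmod[of "- S"] normS pi_gt3 by simp
  ultimately have "Ln (F_fun x) = - S"
    by (simp add: Ln_exp abs_less_iff)
  then show ?thesis
    unfolding S_def using abs_summable_summable[OF R(1)] by simp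
qed

lemma Ln_F_fun_expansion:
  fixes x :: "nat \<Rightarrow> complex"
  assumes x: "x \<in> D_space" and less: "(\<Sum>\<^sub>\<infinity>k\<in>{1..}. norm (x k * x (k + 1))) < ln 2"
  shows "(\<forall>l\<ge>1. \<forall>m\<in>multiindices l.
        (\<lambda>k. \<Prod>j = 1..l. (x (k + j - 1) * x (k + j)) ^ m j) summable_on {1..}) \<and>
    (\<forall>l\<ge>1. (\<lambda>m. alpha_coeff l m * (\<Sum>\<^sub>\<infinity>k\<in>{1..}. \<Prod>j = 1..l. (x (k + j - 1) * x (k + j)) ^ m j))
        summable_on multiindices l) \<and>
    (\<lambda>l. \<Sum>\<^sub>\<infinity>m\<in>multiindices l. alpha_coeff l m *
        (\<Sum>\<^sub>\<infinity>k\<in>{1..}. \<Prod>j = 1..l. (x (k + j - 1) * x (k + j)) ^ m j)) summable_on {1..} \<and>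
    Ln (F_fun x) = - (\<Sum>\<^sub>\<infinity>l\<in>{1..}. \<Sum>\<^sub>\<infinity>m\<in>multiindices l. alpha_coeff l m *
        (\<Sum>\<^sub>\<infinity>k\<in>{1..}. \<Prod>j = 1..l. (x (k + j - 1) * x (k + j)) ^ m j))"
proof -
  define w where "w = (\<lambda>k. x k * x (k + 1))"
  define f where "f = (\<lambda>(k, ps). log_weight ps * list_monom w k ps)"
  define h where "h = (\<lambda>ps. log_weight ps * (\<Sum>\<^sub>\<infinity>k\<in>{1..}. list_monom w k ps))"
  define H where "H = (\<lambda>l m. alpha_coeff l m * (\<Sum>\<^sub>\<infinity>k\<in>{1..}. \<Prod>j = 1..l. (x (k + j - 1) * x (k + j)) ^ m j))"
  have f: "f summable_on {1..} \<times> all_pos_lists" and Ln: "Ln (F_fun x) = - infsum f ({1..} \<times> all_pos_lists)"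
    using Ln_F_fun[OF x less] by (auto simp: f_def w_def)
  have swap: "bij_betw prod.swap (all_pos_lists \<times> {1..}) ({1..} \<times> all_pos_lists)"
    by (auto simp: bij_betw_def)
  have f': "(\<lambda>q. f (prod.swap q)) summable_on all_pos_lists \<times> {1..}"
    using f summable_on_reindex_bij_betw[OF swap, of f] by simp
  have slice: "(\<lambda>k. list_monom w k ps) summable_on {1..}" if "ps \<in> all_pos_lists" for ps
  proof -
    have "(\<lambda>(ps, k). f (k, ps)) summable_on all_pos_lists \<times> {1..}"
      using f' by (simp add: case_prod_unfold prod.swap_def)
    from summable_on_SigmaD1[OF this that] have "(\<lambda>k. log_weight ps * list_monom w k ps) summable_on {1..}"
      by (simp add: f_def)
    then show ?thesis
      by (subst (asm) summable_on_cmult_right'[OF log_weight_nonzero[OF that]])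
  qed
  have h: "h ps = (\<Sum>\<^sub>\<infinity>k\<in>{1..}. f (k, ps))" for ps
    by (simp add: h_def f_def infsum_cmult_right')
  have h_summ: "h summable_on all_pos_lists"
    using summable_on_Sigma_banach[of "\<lambda>ps k. f (k, ps)" all_pos_lists "\<lambda>_. {1..}"] f'
    unfolding h by (simp add: case_prod_unfold prod.swap_def)
  have h_sum: "infsum h all_pos_lists = infsum f ({1..} \<times> all_pos_lists)"
  proof -
    have "infsum h all_pos_lists = (\<Sum>\<^sub>\<infinity>ps\<in>all_pos_lists. \<Sum>\<^sub>\<infinity>k\<in>{1..}. f (prod.swap (ps, k)))"
      by (intro infsum_cong) (simp add: h)
    also have "\<dots> = infsum (\<lambda>q. f (prod.swap q)) (all_pos_lists \<times> {1..})"
      by (rule infsum_Sigma_banach[OF f'])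
    also have "\<dots> = infsum f ({1..} \<times> all_pos_lists)"
      by (rule infsum_reindex_bij_betw[OF swap])
    finally show ?thesis .
  qed
  have H: "h (list_of l m) = H l m" if "1 \<le> l" for l m
    unfolding h_def H_def w_def log_weight_list_of[OF that] list_monom_list_of ..
  have H_eq: "h (case q of (l, m) \<Rightarrow> list_of l m) = (case q of (l, m) \<Rightarrow> H l m)"
    if "q \<in> Sigma {1..} multiindices" for q
    using that H by auto
  note bij = bij_betw_list_of_Sigma(2)
  have H_summ: "(\<lambda>(l, m). H l m) summable_on Sigma {1..} multiindices"
  proof -
    have "(\<lambda>q. h (case q of (l, m) \<Rightarrow> list_of l m)) summable_on Sigma {1..} multiindices"
      by (subst summable_on_reindex_bij_betw[OF bij, of h]) (rule h_summ)
    then show ?thesis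
      by (rule summable_on_cong[THEN iffD1, rotated]) (rule H_eq)
  qed
  have H_sum: "infsum (\<lambda>(l, m). H l m) (Sigma {1..} multiindices) = infsum h all_pos_lists"
    by (subst infsum_reindex_bij_betw[OF bij, of h, symmetric]) (auto intro!: infsum_cong simp: H)
  have "(\<lambda>k. \<Prod>j = 1..l. (x (k + j - 1) * x (k + j)) ^ m j) summable_on {1..}"
    if "1 \<le> l" "m \<in> multiindices l" for l m
  proof -
    have "list_of l m \<in> all_pos_lists"
      using bij_betw_apply[OF bij, of "(l, m)"] that by simp
    from slice[OF this] show ?thesis
      by (simp only: w_def list_monom_list_of)
  qed
  moreover have "H l summable_on multiindices l" if "1 \<le> l" for l
    using summable_on_SigmaD1[OF H_summ, of l] that by simp
  moreover have "(\<lambda>l. infsum (H l) (multiindices l)) summable_on {1..}"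
    using summable_on_Sigma_banach[OF H_summ] by simp
  moreover have "(\<Sum>\<^sub>\<infinity>l\<in>{1..}. infsum (H l) (multiindices l)) = infsum f ({1..} \<times> all_pos_lists)"
    using infsum_Sigma'_banach[OF H_summ] H_sum h_sum by simp
  ultimately show ?thesis
    unfolding Ln H_def by simp
qed

section \<open>The formal logarithm\<close>

text \<open>
  The Euler operator, which multiplies each monomial by its total degree. It is a continuous
  derivation whose kernel in characteristic \<open>0\<close> consists of the constants.
\<close>

definition euler_deriv :: "'a::comm_ring_1 mfps \<Rightarrow> 'a mfps"
  where "euler_deriv f = MFPS (\<lambda>u. of_nat (monom_degree u) * mfps_coeff f u)"

lemma mfps_coeff_euler_deriv [simp]:
  "mfps_coeff (euler_deriv f) u = of_nat (monom_degree u) * mfps_coeff f u"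
  by (simp add: euler_deriv_def)

lemma euler_deriv_add: "euler_deriv (f + g) = euler_deriv f + euler_deriv g"
  by (rule mfps_eqI) (simp add: algebra_simps)

lemma euler_deriv_diff: "euler_deriv (f - g) = euler_deriv f - euler_deriv g"
  by (rule mfps_eqI) (simp add: algebra_simps)

lemma euler_deriv_uminus: "euler_deriv (- f) = - euler_deriv f"
  by (rule mfps_eqI) simp

lemma euler_deriv_1 [simp]: "euler_deriv 1 = 0"
  by (rule mfps_eqI) (simp add: mfps_coeff_1 monom_degree_def)

lemma euler_deriv_const_mult: "euler_deriv (mfps_const c * f) = mfps_const c * euler_deriv f"
  by (rule mfps_eqI) (simp add: mult.left_commute)

lemma euler_deriv_mult: "euler_deriv (f * g) = euler_deriv f * g + f * euler_deriv g"
proof (rule mfps_eqI)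
  fix u
  show "mfps_coeff (euler_deriv (f * g)) u = mfps_coeff (euler_deriv f * g + f * euler_deriv g) u"
    unfolding mfps_coeff_euler_deriv mfps_coeff_add mfps_coeff_mult sum.distrib[symmetric] sum_distrib_left
    by (rule sum.cong) (auto simp: monom_splits_def monom_degree_add algebra_simps)
qed

lemma euler_deriv_power: "euler_deriv (f ^ Suc n) = of_nat (Suc n) * f ^ n * euler_deriv f"
proof (induction n)
  case (Suc n)
  have "euler_deriv (f ^ Suc (Suc n)) = euler_deriv f * f ^ Suc n + f * euler_deriv (f ^ Suc n)"
    by (simp only: power_Suc[of f "Suc n"] euler_deriv_mult)
  also have "\<dots> = of_nat (Suc (Suc n)) * f ^ Suc n * euler_deriv f"
    unfolding Suc by (simp add: algebra_simps)
  finally show ?case .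
qed simp

lemma has_sum_euler_deriv:
  assumes "(f has_sum s) A"
  shows "((\<lambda>i. euler_deriv (f i)) has_sum euler_deriv s) A"
proof -
  have "(euler_deriv \<circ> f has_sum euler_deriv s) A"
  proof (rule has_sum_comm_additive_general)
    show "sum (euler_deriv \<circ> f) F = euler_deriv (sum f F)" if "finite F" "F \<subseteq> A" for F
      using that by (induction F rule: finite_induct) (auto simp: euler_deriv_add intro: mfps_eqI)
    show "euler_deriv \<midarrow>s\<rightarrow> euler_deriv s"
      unfolding tendsto_mfps_iff
    proof
      fix u
      have "\<forall>\<^sub>F x in at s. mfps_coeff x u = mfps_coeff s u"
        using tendsto_mfps_iff[of "\<lambda>x. x" s "at s"] tendsto_ident_at[of s UNIV] by blast
      then show "\<forall>\<^sub>F x in at s. mfps_coeff (euler_deriv x) u = mfps_coeff (euler_deriv s) u"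
        by eventually_elim simp
    qed
  qed (rule assms)
  then show ?thesis
    by (simp add: o_def)
qed

lemma euler_deriv_eqD:
  fixes f g :: "'a::field_char_0 mfps"
  assumes "euler_deriv f = euler_deriv g" "mfps_coeff f 0 = mfps_coeff g 0"
  shows "f = g"
proof (rule mfps_eqI)
  fix u
  have "of_nat (monom_degree u) * mfps_coeff f u = of_nat (monom_degree u) * mfps_coeff g u"
    using arg_cong[OF assms(1), of "\<lambda>h. mfps_coeff h u"] by simp
  then show "mfps_coeff f u = mfps_coeff g u"
    using assms(2) by (cases "u = 0") auto
qed

lemma order_ge_const_mult_power:
  fixes y :: "'a::comm_ring_1 mfps"
  assumes "order_ge 1 y"
  shows "order_ge p (c * y ^ p)"
  using order_ge_mult_left[OF order_ge_power[OF assms, of p], of c] by simp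

lemma summable_on_powser_mfps:
  fixes y :: "'a::comm_ring_1 mfps"
  assumes "order_ge 1 y"
  shows "(\<lambda>p. c p * y ^ p) summable_on {1..}"
  by (rule summable_on_mfps[where d = "\<lambda>p. p"]) (auto intro: order_ge_const_mult_power assms)

lemma mfps_log_has_sum:
  fixes y :: "'a::field_char_0 mfps"
  assumes y: "order_ge 1 y"
  shows "((\<lambda>p. mfps_const (1 / of_nat p) * y ^ p) has_sum - mfps_log (1 - y)) {1..}"
proof -
  have eq: "mfps_const (1 / of_nat p) * y ^ p = - (mfps_const ((- 1) ^ (p + 1) / of_nat p) * (1 - y - 1) ^ p)" for p
  proof (rule mfps_eqI)
    fix u
    have "(1 - y - 1) ^ p = (- 1) ^ p * y ^ p"
      by (simp flip: power_mult_distrib)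
    also have "\<dots> = mfps_const ((- 1) ^ p) * y ^ p"
      by (cases "even p") (auto intro: mfps_eqI)
    finally show "mfps_coeff (mfps_const (1 / of_nat p) * y ^ p) u =
        mfps_coeff (- (mfps_const ((- 1) ^ (p + 1) / of_nat p) * (1 - y - 1) ^ p)) u"
      by (cases "even p") auto
  qed
  have "(\<lambda>p. mfps_const ((- 1) ^ (p + 1) / of_nat p) * (1 - y - 1) ^ p) summable_on {1..}"
    by (rule summable_on_powser_mfps) (use y in \<open>simp add: order_ge_def\<close>)
  then have "((\<lambda>p. mfps_const ((- 1) ^ (p + 1) / of_nat p) * (1 - y - 1) ^ p) has_sum mfps_log (1 - y)) {1..}"
    unfolding mfps_log_def by simp
  then show ?thesis
    unfolding eq by (rule has_sum_uminusI)
qed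

lemma mfps_coeff_log_0:
  fixes y :: "'a::field_char_0 mfps"
  assumes y: "order_ge 1 y"
  shows "mfps_coeff (mfps_log (1 - y)) 0 = 0"
proof -
  have z: "mfps_coeff (mfps_const (1 / of_nat p) * y ^ p) 0 = 0" if "p \<in> {1..}" for p
    using order_ge_mono[OF order_ge_const_mult_power[OF y, of p "mfps_const (1 / of_nat p)"], of 1] that
    by (simp only: order_ge_1_iff) simp
  have "mfps_coeff (- mfps_log (1 - y)) 0 = 0"
    using mfps_log_has_sum[OF y] z unfolding has_sum_mfps_iff
    by (metis (mono_tags, lifting) mem_Collect_eq sum.neutral)
  then show ?thesis
    by simp
qed

lemma mfps_one_minus_inverse:
  fixes y :: "'a::comm_ring_1 mfps"
  assumes y: "order_ge 1 y"
  shows "\<exists>h. (1 - y) * h = 1 \<and> ((\<lambda>p. y ^ p) has_sum h) UNIV"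
proof -
  obtain h where h: "(1 - y) * h = 1"
    and geo: "\<And>s. ((\<lambda>p. of_nat ((s + p - 1) choose p) * y ^ p) has_sum (h ^ s - 1)) {1..}"
    using neg_binomial_has_sum[of y, OF summable_on_powser_mfps[OF y]] by auto
  have "UNIV = insert 0 {1::nat..}"
    by auto
  then have "((\<lambda>p. y ^ p) has_sum h) UNIV"
    using has_sum_insert[of 0 "{1..}" "\<lambda>p. y ^ p" "h - 1"] geo[of 1] by simp
  with h show ?thesis
    by blast
qed

lemma mfps_coeff_of_nat_mult:
  "mfps_coeff (of_nat n * f :: 'a::comm_ring_1 mfps) u = of_nat n * mfps_coeff f u"
  by (induction n) (simp_all add: algebra_simps)

text \<open>The logarithmic derivative, in a form without division.\<close>

lemma euler_deriv_log:
  fixes f :: "'a::field_char_0 mfps"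
  assumes f: "order_ge 1 (1 - f)"
  shows "f * euler_deriv (mfps_log f) = euler_deriv f"
proof -
  define y where "y = 1 - f"
  have y: "order_ge 1 y" and fy: "f = 1 - y"
    using f by (simp_all add: y_def)
  obtain h where h: "(1 - y) * h = 1" and geo: "((\<lambda>p. y ^ p) has_sum h) UNIV"
    using mfps_one_minus_inverse[OF y] by blast
  have E: "euler_deriv (mfps_const (1 / of_nat (Suc p)) * y ^ Suc p) = euler_deriv y * y ^ p" for p
  proof (rule mfps_eqI)
    fix u
    have "mfps_coeff (euler_deriv (mfps_const (1 / of_nat (Suc p)) * y ^ Suc p)) u =
        1 / of_nat (Suc p) * (of_nat (Suc p) * mfps_coeff (y ^ p * euler_deriv y) u)"
      by (simp only: euler_deriv_const_mult euler_deriv_power mfps_coeff_const_mult mult.assoc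
            mfps_coeff_of_nat_mult)
    also have "\<dots> = mfps_coeff (euler_deriv y * y ^ p) u"
      by (simp only: mult.commute[of "y ^ p"]) (simp del: of_nat_Suc)
    finally show "mfps_coeff (euler_deriv (mfps_const (1 / of_nat (Suc p)) * y ^ Suc p)) u =
        mfps_coeff (euler_deriv y * y ^ p) u" .
  qed
  have Suc_UNIV: "{1..} = Suc ` UNIV"
    by (auto simp: image_iff Suc_le_eq gr0_conv_Suc)
  have "((\<lambda>p. euler_deriv (mfps_const (1 / of_nat p) * y ^ p)) has_sum euler_deriv (- mfps_log (1 - y))) {1..}"
    by (intro has_sum_euler_deriv mfps_log_has_sum y)
  then have "((\<lambda>p. euler_deriv y * y ^ p) has_sum euler_deriv (- mfps_log (1 - y))) UNIV"
    unfolding Suc_UNIV by (subst (asm) has_sum_reindex) (auto simp only: o_def E inj_Suc)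
  then have "euler_deriv (- mfps_log (1 - y)) = euler_deriv y * h"
    using has_sum_cmult_right[OF geo, of "euler_deriv y"] has_sum_unique by blast
  then have "euler_deriv (mfps_log f) = - (h * euler_deriv y)"
    unfolding fy by (simp add: euler_deriv_uminus minus_equation_iff mult.commute)
  then have "f * euler_deriv (mfps_log f) = - ((1 - y) * h * euler_deriv y)"
    unfolding fy by (simp only: mult.assoc mult_minus_right)
  also have "\<dots> = euler_deriv f"
    unfolding h fy by (simp add: euler_deriv_diff)
  finally show ?thesis .
qed

lemma mfps_unit_cancel:
  fixes f :: "'a::comm_ring_1 mfps"
  assumes f: "order_ge 1 (1 - f)" and eq: "f * g = f * g'"
  shows "g = g'"
proof -
  obtain h where "f * h = 1"
    using mfps_one_minus_inverse[OF f] by auto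
  then show ?thesis
    using arg_cong[OF eq, of "(*) h"] by (simp add: mult.assoc[symmetric] mult.commute[of h])
qed

lemma order_ge_1_one_minus_mult:
  fixes f g :: "'a::comm_ring_1 mfps"
  assumes f: "order_ge 1 (1 - f)" and g: "order_ge 1 (1 - g)"
  shows "order_ge 1 (1 - f * g)"
proof -
  have eq: "1 - f * g = (1 - f) + f * (1 - g)"
    by (simp add: algebra_simps)
  show ?thesis
    unfolding eq using f order_ge_mult_left[OF g, of f] by (simp add: order_ge_def)
qed

text \<open>Both sides have the same Euler derivative and the same constant term \<open>0\<close>.\<close>

lemma mfps_log_mult:
  fixes f g :: "'a::field_char_0 mfps"
  assumes f: "order_ge 1 (1 - f)" and g: "order_ge 1 (1 - g)"
  shows "mfps_log (f * g) = mfps_log f + mfps_log g"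
proof (rule euler_deriv_eqD)
  note fg = order_ge_1_one_minus_mult[OF f g]
  have log0: "mfps_coeff (mfps_log h) 0 = 0" if "order_ge 1 (1 - h)" for h :: "'a mfps"
    using mfps_coeff_log_0[OF that] by simp
  show "mfps_coeff (mfps_log (f * g)) 0 = mfps_coeff (mfps_log f + mfps_log g) 0"
    using log0[OF f] log0[OF g] log0[OF fg] by simp
  have "f * g * euler_deriv (mfps_log (f * g)) =
      (f * euler_deriv (mfps_log f)) * g + f * (g * euler_deriv (mfps_log g))"
    unfolding euler_deriv_log[OF f] euler_deriv_log[OF g] euler_deriv_log[OF fg] by (rule euler_deriv_mult)
  also have "\<dots> = f * g * euler_deriv (mfps_log f + mfps_log g)"
    by (simp add: euler_deriv_add algebra_simps)
  finally show "euler_deriv (mfps_log (f * g)) = euler_deriv (mfps_log f + mfps_log g)"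
    by (rule mfps_unit_cancel[OF fg])
qed

lemma mfps_log_1 [simp]: "mfps_log (1 :: 'a::field_char_0 mfps) = 0"
proof -
  have "order_ge 1 (1 - 1 :: 'a mfps)"
    by (simp add: order_ge_def)
  from mfps_log_mult[OF this this] show ?thesis
    by simp
qed

lemma mfps_log_prod:
  fixes f :: "'b \<Rightarrow> 'a::field_char_0 mfps"
  assumes "finite A" "\<And>i. i \<in> A \<Longrightarrow> order_ge 1 (1 - f i)"
  shows "mfps_log (prod f A) = (\<Sum>i\<in>A. mfps_log (f i))"
proof -
  have "order_ge 1 (1 - prod f A) \<and> mfps_log (prod f A) = (\<Sum>i\<in>A. mfps_log (f i))"
    using assms
  proof (induction A rule: finite_induct)
    case empty
    show ?case
      by (simp add: order_ge_def)
  next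
    case (insert i A)
    then show ?case
      using mfps_log_mult[of "f i" "prod f A"] order_ge_1_one_minus_mult[of "f i" "prod f A"] by simp
  qed
  then show ?thesis ..
qed

section \<open>The logarithm of \<open>\<FF>\<close> as a formal power series\<close>

lemma order_ge_list_monom:
  fixes w :: "nat \<Rightarrow> 'a::comm_ring_1 mfps"
  assumes "\<And>k. order_ge 1 (w k)"
  shows "order_ge (sum_list ps) (list_monom w k ps)"
proof (induction ps arbitrary: k)
  case (Cons p ps)
  show ?case
    using order_ge_mult[OF order_ge_power[OF assms[of k], of p] Cons.IH[of "Suc k"]] by simp
qed simp

lemma finite_pos_lists_sum_le: "finite {ps \<in> ne_pos_lists L. sum_list ps \<le> N}"
proof (rule finite_subset[OF _ finite_lists_length_le[of "{..N}" L]])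
  show "{ps \<in> ne_pos_lists L. sum_list ps \<le> N} \<subseteq> {xs. set xs \<subseteq> {..N} \<and> length xs \<le> L}"
    using member_le_sum_list by (fastforce simp: ne_pos_lists_def pos_lists_def)
qed simp

lemma summable_on_list_monom_mfps:
  fixes w :: "nat \<Rightarrow> 'a::comm_ring_1 mfps"
  assumes "\<And>k. order_ge 1 (w k)"
    and A: "A \<subseteq> ne_pos_lists L"
  shows "(\<lambda>ps. c ps * list_monom w k ps) summable_on A"
proof (rule summable_on_mfps[where d = sum_list])
  show "order_ge (sum_list ps) (c ps * list_monom w k ps)" for ps
    by (intro order_ge_mult_left order_ge_list_monom assms)
  show "finite {ps \<in> A. sum_list ps \<le> N}" for N
    by (rule finite_subset[OF _ finite_pos_lists_sum_le[of L N]]) (use A in auto)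
qed

lemma cf_sum_mfps:
  fixes w :: "nat \<Rightarrow> 'a::comm_ring_1 mfps"
  assumes w: "\<And>k. order_ge 1 (w k)"
  shows "((\<lambda>ps. of_nat (nb_weight s ps) * list_monom w k ps) has_sum cf_sum w k L ^ s) (pos_lists L) \<and>
    (1 - w k * cf_sum w (Suc k) L) * cf_sum w k (Suc L) = 1"
proof (induction L arbitrary: k s)
  case 0
  have y: "order_ge 1 (w k * cf_sum w (Suc k) 0)" for k
    using w by simp
  have "((\<lambda>ps. of_nat (nb_weight s ps) * list_monom w k ps) has_sum cf_sum w k 0 ^ s) (pos_lists 0)" for k s
    by (auto simp: pos_lists_0 intro!: has_sum_finiteI)
  then show ?case
    using cf_sum_step(1)[OF _ summable_on_powser_mfps[OF y] summable_on_list_monom_mfps[OF w order_refl]] by blast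
next
  case (Suc L)
  have y: "order_ge 1 (w k * cf_sum w (Suc k) L)" for k L
    using order_ge_mult[OF w order_ge_0] by simp
  have *: "((\<lambda>ps. of_nat (nb_weight s ps) * list_monom w k ps) has_sum cf_sum w k (Suc L) ^ s) (pos_lists (Suc L))" for k s
    by (rule cf_sum_step(2)[OF _ summable_on_powser_mfps[OF y] summable_on_list_monom_mfps[OF w order_refl]])
       (use Suc.IH in blast)
  then show ?case
    using cf_sum_step(1)[OF * summable_on_powser_mfps[OF y] summable_on_list_monom_mfps[OF w order_refl]] by blast
qed

lemma log_list_sum_mfps:
  fixes w :: "nat \<Rightarrow> 'a::field_char_0 mfps"
  assumes w: "\<And>k. order_ge 1 (w k)"
  shows "((\<lambda>ps. mfps_const (log_weight ps) * list_monom w k ps) has_sum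
    - mfps_log (1 - w k * cf_sum w (Suc k) L)) (ne_pos_lists (Suc L))"
proof -
  have y: "order_ge 1 (w k * cf_sum w (Suc k) L)"
    using order_ge_mult[OF w order_ge_0] by simp
  have eq: "mfps_const (log_weight ps) * f = mfps_const (1 / of_nat (hd ps)) * of_nat (nb_weight (hd ps) (tl ps)) * f"
    for ps and f :: "'a mfps"
    by (rule mfps_eqI) (simp add: mult.assoc mfps_coeff_of_nat_mult log_weight_def)
  show ?thesis
    unfolding eq
    by (rule has_sum_ne_pos_lists[OF conjunct1[OF cf_sum_mfps[OF w]] mfps_log_has_sum[OF y]
          summable_on_list_monom_mfps[OF w order_refl]])
qed

lemma order_ge_var: "order_ge 1 (mfps_var k :: 'a::comm_ring_1 mfps)"
  unfolding order_ge_def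
proof (intro allI impI)
  fix u assume "monom_degree u < 1"
  then have "u \<noteq> Poly_Mapping.single k 1"
    by (metis less_irrefl monom_degree_single)
  then show "mfps_coeff (mfps_var k :: 'a mfps) u = 0"
    by (simp add: mfps_var_def)
qed

lemma has_sum_sum:
  fixes f :: "'c \<Rightarrow> 'b \<Rightarrow> 'a::topological_comm_monoid_add"
  assumes "finite K" "\<And>k. k \<in> K \<Longrightarrow> (f k has_sum s k) A"
  shows "((\<lambda>i. \<Sum>k\<in>K. f k i) has_sum (\<Sum>k\<in>K. s k)) A"
  using assms by (induction K rule: finite_induct) (auto intro!: has_sum_add)

lemma list_monom_cong:
  assumes "\<And>i. k \<le> i \<Longrightarrow> i < k + length ps \<Longrightarrow> v i = w i"
  shows "list_monom v k ps = list_monom w k ps"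
  using assms by (induction ps arbitrary: k) auto

lemma mfps_log_F_fun_expansion:
  fixes n :: nat
  assumes n: "1 \<le> n"
  shows "(\<forall>l\<in>{1..n - 1}.
        (\<lambda>m. mfps_const (alpha_coeff l m) *
           (\<Sum>k = 1..n - l. \<Prod>j = 1..l. (mfps_var (k + j - 1) * mfps_var (k + j)) ^ m j))
        summable_on multiindices l) \<and>
    mfps_log (F_fun (truncate_seq n (mfps_var :: nat \<Rightarrow> complex mfps))) =
      - (\<Sum>l = 1..n - 1. \<Sum>\<^sub>\<infinity>m\<in>multiindices l. mfps_const (alpha_coeff l m) *
          (\<Sum>k = 1..n - l. \<Prod>j = 1..l. (mfps_var (k + j - 1) * mfps_var (k + j)) ^ m j))"
proof -
  define x :: "nat \<Rightarrow> complex mfps" where "x = truncate_seq n mfps_var"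
  define w where "w = (\<lambda>k. x k * x (k + 1))"
  define v :: "nat \<Rightarrow> complex mfps" where "v = (\<lambda>k. mfps_var k * mfps_var (k + 1))"
  define g where "g = (\<lambda>k l m. mfps_const (alpha_coeff l m) * list_monom v k (list_of l m))"
  \<comment> \<open>\<open>v\<close> is the untruncated counterpart of \<open>w\<close>; the two agree on the indices \<open>1 \<le> i < n\<close> that occur.\<close>
  have x: "order_ge 1 (x k)" for k
    using order_ge_var[of k] by (auto simp: x_def truncate_seq_def order_ge_def)
  have w: "order_ge 1 (w k)" for k
    unfolding w_def by (rule order_ge_mult_left[OF x])
  have zero: "w k = 0" if "n \<le> k" for k
    using that by (simp add: w_def x_def truncate_seq_def)
  have w_eq_v: "w i = v i" if "1 \<le> i" "i < n" for i
    using that by (simp add: w_def v_def x_def truncate_seq_def)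
  have y: "order_ge 1 (w k * h)" for k h
    using order_ge_mult[OF w order_ge_0] by simp
  have F: "F_fun x = (\<Prod>i = 1..<n. 1 - w i * cf_sum w (Suc i) (n - Suc i))"
  proof (rule F_fun_finite_eq_prod[OF _ zero _ n])
    fix k assume "k < n"
    then show "(1 - w k * cf_sum w (Suc k) (n - Suc k)) * cf_sum w k (n - k) = 1"
      using cf_sum_mfps[of w, OF w, where k = k and L = "n - Suc k"] by (simp add: Suc_diff_Suc)
  qed (simp add: w_def)
  have log: "mfps_log (F_fun x) = (\<Sum>k = 1..<n. mfps_log (1 - w k * cf_sum w (Suc k) (n - Suc k)))"
    unfolding F by (rule mfps_log_prod) (use y in auto)
  have total: "((\<lambda>(l, m). g k l m) has_sum - mfps_log (1 - w k * cf_sum w (Suc k) (n - Suc k)))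
      (Sigma {1..n - k} multiindices)" if k: "k \<in> {1..<n}" for k
  proof -
    have "((\<lambda>ps. mfps_const (log_weight ps) * list_monom w k ps) has_sum
        - mfps_log (1 - w k * cf_sum w (Suc k) (n - Suc k))) (ne_pos_lists (n - k))"
      using log_list_sum_mfps[of w, OF w, where k = k and L = "n - Suc k"] k by (simp add: Suc_diff_Suc)
    then have "((\<lambda>q. (\<lambda>ps. mfps_const (log_weight ps) * list_monom w k ps) (case q of (l, m) \<Rightarrow> list_of l m))
        has_sum - mfps_log (1 - w k * cf_sum w (Suc k) (n - Suc k))) (Sigma {1..n - k} multiindices)"
      by (subst has_sum_reindex_bij_betw[OF bij_betw_list_of_Sigma(1)])
    moreover have "mfps_const (log_weight (list_of l m)) * list_monom w k (list_of l m) = g k l m"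
      if "l \<in> {1..n - k}" for l m
    proof -
      have "list_monom w k (list_of l m) = list_monom v k (list_of l m)"
        by (rule list_monom_cong) (use that k in \<open>auto intro!: w_eq_v\<close>)
      then show ?thesis
        using that by (simp add: g_def log_weight_list_of)
    qed
    ultimately show ?thesis
      by (auto elim!: has_sum_cong[THEN iffD1, rotated])
  qed
  have v: "order_ge 1 (v k)" for k
    unfolding v_def by (rule order_ge_mult_left[OF order_ge_var])
  have g_has_sum: "(g k l has_sum infsum (g k l) (multiindices l)) (multiindices l)" if "1 \<le> l" for k l
  proof -
    have "(\<lambda>ps. mfps_const (log_weight ps) * list_monom v k ps)
        summable_on {ps. set ps \<subseteq> {1..} \<and> length ps = l}"
      by (rule summable_on_list_monom_mfps[OF v, of _ l])
         (use that in \<open>auto simp: ne_pos_lists_def pos_lists_def\<close>)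
    then have "(\<lambda>m. mfps_const (log_weight (list_of l m)) * list_monom v k (list_of l m))
        summable_on multiindices l"
      by (subst summable_on_reindex_bij_betw[OF bij_betw_list_of])
    then show ?thesis
      using that by (simp add: g_def log_weight_list_of)
  qed
  have log_k: "- mfps_log (1 - w k * cf_sum w (Suc k) (n - Suc k)) =
      (\<Sum>l\<in>{l \<in> {1..n - 1}. k + l \<le> n}. infsum (g k l) (multiindices l))" if k: "k \<in> {1..<n}" for k
  proof -
    have "((\<lambda>l. infsum (g k l) (multiindices l)) has_sum
        - mfps_log (1 - w k * cf_sum w (Suc k) (n - Suc k))) {1..n - k}"
      by (rule has_sum_SigmaD[OF total[OF k]]) (use g_has_sum in auto)
    then have "- mfps_log (1 - w k * cf_sum w (Suc k) (n - Suc k)) =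
        (\<Sum>l = 1..n - k. infsum (g k l) (multiindices l))"
      using has_sum_unique has_sum_finite[of "{1..n - k}"] by blast
    also have "{1..n - k} = {l \<in> {1..n - 1}. k + l \<le> n}"
      using k by auto
    finally show ?thesis .
  qed
  have G: "((\<lambda>m. mfps_const (alpha_coeff l m) *
          (\<Sum>k = 1..n - l. \<Prod>j = 1..l. (mfps_var (k + j - 1) * mfps_var (k + j)) ^ m j)) has_sum
        (\<Sum>k = 1..n - l. infsum (g k l) (multiindices l))) (multiindices l)" if "1 \<le> l" for l
  proof -
    have "((\<lambda>m. \<Sum>k = 1..n - l. g k l m) has_sum (\<Sum>k = 1..n - l. infsum (g k l) (multiindices l)))
        (multiindices l)"
      by (intro has_sum_sum g_has_sum that) auto
    then show ?thesis
      by (simp only: g_def v_def list_monom_list_of sum_distrib_left)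
  qed
  have "- mfps_log (F_fun x) = (\<Sum>k = 1..<n. - mfps_log (1 - w k * cf_sum w (Suc k) (n - Suc k)))"
    unfolding log by (simp add: sum_negf)
  also have "\<dots> = (\<Sum>k = 1..<n. \<Sum>l\<in>{l \<in> {1..n - 1}. k + l \<le> n}. infsum (g k l) (multiindices l))"
    by (rule sum.cong[OF refl log_k])
  also have "\<dots> = (\<Sum>l = 1..n - 1. \<Sum>k\<in>{k \<in> {1..<n}. k + l \<le> n}. infsum (g k l) (multiindices l))"
    by (rule sum.swap_restrict) auto
  also have "\<dots> = (\<Sum>l = 1..n - 1. \<Sum>k = 1..n - l. infsum (g k l) (multiindices l))"
    by (intro sum.cong) auto
  also have "\<dots> = (\<Sum>l = 1..n - 1. \<Sum>\<^sub>\<infinity>m\<in>multiindices l. mfps_const (alpha_coeff l m) *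
      (\<Sum>k = 1..n - l. \<Prod>j = 1..l. (mfps_var (k + j - 1) * mfps_var (k + j)) ^ m j))"
    by (rule sum.cong[OF refl], rule infsumI[OF G, symmetric]) auto
  finally have neg: "- mfps_log (F_fun x) = (\<Sum>l = 1..n - 1. \<Sum>\<^sub>\<infinity>m\<in>multiindices l. mfps_const (alpha_coeff l m) *
      (\<Sum>k = 1..n - l. \<Prod>j = 1..l. (mfps_var (k + j - 1) * mfps_var (k + j)) ^ m j))" .
  show ?thesis
  proof (intro conjI ballI)
    fix l assume "l \<in> {1..n - 1}"
    then show "(\<lambda>m. mfps_const (alpha_coeff l m) *
        (\<Sum>k = 1..n - l. \<Prod>j = 1..l. (mfps_var (k + j - 1) * mfps_var (k + j)) ^ m j))
        summable_on multiindices l"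
      by (intro has_sum_imp_summable[OF G]) simp
  qed (simp only: neg[symmetric] minus_minus x_def)
qed

section \<open>The two expansions\<close>

theorem proposition3:
  shows
    "(\<forall>n\<ge>1.
       (\<forall>l\<in>{1..n - 1}.
          (\<lambda>m. mfps_const (alpha_coeff l m) *
             (\<Sum>k = 1..n - l. \<Prod>j = 1..l. (mfps_var (k + j - 1) * mfps_var (k + j)) ^ m j))
          summable_on multiindices l) \<and>
       mfps_log (F_fun (truncate_seq n (mfps_var :: nat \<Rightarrow> complex mfps))) =
         - (\<Sum>l = 1..n - 1. \<Sum>\<^sub>\<infinity>m\<in>multiindices l. mfps_const (alpha_coeff l m) *
             (\<Sum>k = 1..n - l. \<Prod>j = 1..l. (mfps_var (k + j - 1) * mfps_var (k + j)) ^ m j)))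
     \<and>
     (\<forall>x\<in>D_space. (\<Sum>\<^sub>\<infinity>k\<in>{1..}. norm (x k * x (k + 1))) < ln 2 \<longrightarrow>
       (\<forall>l\<ge>1. \<forall>m\<in>multiindices l.
          (\<lambda>k. \<Prod>j = 1..l. (x (k + j - 1) * x (k + j)) ^ m j) summable_on {1..}) \<and>
       (\<forall>l\<ge>1.
          (\<lambda>m. alpha_coeff l m * (\<Sum>\<^sub>\<infinity>k\<in>{1..}. \<Prod>j = 1..l. (x (k + j - 1) * x (k + j)) ^ m j))
          summable_on multiindices l) \<and>
       (\<lambda>l. \<Sum>\<^sub>\<infinity>m\<in>multiindices l. alpha_coeff l m *
            (\<Sum>\<^sub>\<infinity>k\<in>{1..}. \<Prod>j = 1..l. (x (k + j - 1) * x (k + j)) ^ m j))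
         summable_on {1..} \<and>
       Ln (F_fun x) =
         - (\<Sum>\<^sub>\<infinity>l\<in>{1..}. \<Sum>\<^sub>\<infinity>m\<in>multiindices l. alpha_coeff l m *
            (\<Sum>\<^sub>\<infinity>k\<in>{1..}. \<Prod>j = 1..l. (x (k + j - 1) * x (k + j)) ^ m j)))"
  using mfps_log_F_fun_expansion Ln_F_fun_expansion by blast

end
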